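(* Let $L\subseteq Q$ be a dense extension of Lie algebras such that $Q$ is a multiplicatively semiprime algebra of quotients of $L$. Then $A_0$ is semiprime and $Q_\sigma(A_0)=Q_\sigma(A(Q))$ (that is, under the inclusions $A_0\subseteq A(Q)\subseteq Q_\sigma(A_0)$, the maximal symmetric rings of quotients of $A_0$ and of $A(Q)$ coincide).
   Context: Lie algebras over a commutative unital ring $\Phi$. $\mathrm{ad}_x(y)=[x,y]$; $A(Q)$ is the associative subalgebra of $\mathrm{End}_\Phi(Q)$ generated by all $\mathrm{ad}_x$, $x\in Q$; $M(Q)$ is generated by the identity and all $\mathrm{ad}_x$. $A_0=\{\mu\in A(Q):\mu(L)\subseteq L\}$. An extension $L\subseteq Q$ is dense if the only $\mu\in M(Q)$ with $\mu(L)=0$ is $\mu=0$. A Lie algebra is semiprime if $[I,I]\ne0$ for each nonzero ideal $I$; $Q$ is multiplicatively semiprime if $Q$ and $M(Q)$ are semiprime. $Q$ is an algebra of quotients of $L$ if for every nonzero $q\in Q$ there is an ideal $J$ of $L$ with $\mathrm{Ann}_L(J)=\{a\in L:[a,J]=0\}=0$ and $0\ne[J,q]\subseteq L$. For a semiprime ring $R$, $Q_\sigma(R)$ is the maximal symmetric ring of quotients of $R$ (Schelter, Lanning): the subring of the maximal right quotient ring $Q^r_{\max}(R)$ of elements $q$ with $Jq\subseteq R$ for some dense left ideal $J$ of $R$. *)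

theory Defs
  imports "HOL-Algebra.Ring"
begin

text \<open>The Lie algebra Q is the whole type 'a (an abelian group), with scalar
action sc of the commutative unital ring 'r and bracket br.\<close>

definition lie_alg :: "('r::comm_ring_1 \<Rightarrow> 'a::ab_group_add \<Rightarrow> 'a) \<Rightarrow> ('a \<Rightarrow> 'a \<Rightarrow> 'a) \<Rightarrow> bool" where
  "lie_alg sc br \<longleftrightarrow>
     (\<forall>c x y. sc c (x + y) = sc c x + sc c y) \<and>
     (\<forall>c d x. sc (c + d) x = sc c x + sc d x) \<and>
     (\<forall>c d x. sc (c * d) x = sc c (sc d x)) \<and>
     (\<forall>x. sc 1 x = x) \<and>
     (\<forall>x y z. br (x + y) z = br x z + br y z) \<and>
     (\<forall>x y z. br x (y + z) = br x y + br x z) \<and>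
     (\<forall>c x y. br (sc c x) y = sc c (br x y)) \<and>
     (\<forall>c x y. br x (sc c y) = sc c (br x y)) \<and>
     (\<forall>x. br x x = 0) \<and>
     (\<forall>x y z. br x (br y z) + br y (br z x) + br z (br x y) = 0)"

definition lie_subalg :: "('r \<Rightarrow> 'a::ab_group_add \<Rightarrow> 'a) \<Rightarrow> ('a \<Rightarrow> 'a \<Rightarrow> 'a) \<Rightarrow> 'a set \<Rightarrow> bool" where
  "lie_subalg sc br L \<longleftrightarrow> 0 \<in> L \<and> (\<forall>x\<in>L. \<forall>y\<in>L. x + y \<in> L) \<and> (\<forall>x\<in>L. - x \<in> L) \<and>
     (\<forall>c. \<forall>x\<in>L. sc c x \<in> L) \<and> (\<forall>x\<in>L. \<forall>y\<in>L. br x y \<in> L)"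

definition lie_ideal :: "('r \<Rightarrow> 'a::ab_group_add \<Rightarrow> 'a) \<Rightarrow> ('a \<Rightarrow> 'a \<Rightarrow> 'a) \<Rightarrow> 'a set \<Rightarrow> 'a set \<Rightarrow> bool" where
  "lie_ideal sc br L I \<longleftrightarrow> I \<subseteq> L \<and> 0 \<in> I \<and> (\<forall>x\<in>I. \<forall>y\<in>I. x + y \<in> I) \<and> (\<forall>x\<in>I. - x \<in> I) \<and>
     (\<forall>c. \<forall>x\<in>I. sc c x \<in> I) \<and> (\<forall>a\<in>L. \<forall>x\<in>I. br a x \<in> I)"

definition lie_semiprime :: "('r \<Rightarrow> 'a::ab_group_add \<Rightarrow> 'a) \<Rightarrow> ('a \<Rightarrow> 'a \<Rightarrow> 'a) \<Rightarrow> 'a set \<Rightarrow> bool" where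
  "lie_semiprime sc br L \<longleftrightarrow>
     (\<forall>I. lie_ideal sc br L I \<and> I \<noteq> {0} \<longrightarrow> (\<exists>a\<in>I. \<exists>b\<in>I. br a b \<noteq> 0))"

definition ad :: "('a \<Rightarrow> 'a \<Rightarrow> 'a) \<Rightarrow> 'a \<Rightarrow> ('a \<Rightarrow> 'a)" where
  "ad br x = (\<lambda>y. br x y)"

inductive_set Aalg :: "('r \<Rightarrow> 'a::ab_group_add \<Rightarrow> 'a) \<Rightarrow> ('a \<Rightarrow> 'a \<Rightarrow> 'a) \<Rightarrow> ('a \<Rightarrow> 'a) set"
  for sc br where
    A_ad: "ad br x \<in> Aalg sc br"
  | A_zero: "(\<lambda>v. 0) \<in> Aalg sc br"
  | A_add: "f \<in> Aalg sc br \<Longrightarrow> g \<in> Aalg sc br \<Longrightarrow> (\<lambda>v. f v + g v) \<in> Aalg sc br"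
  | A_neg: "f \<in> Aalg sc br \<Longrightarrow> (\<lambda>v. - f v) \<in> Aalg sc br"
  | A_smult: "f \<in> Aalg sc br \<Longrightarrow> (\<lambda>v. sc c (f v)) \<in> Aalg sc br"
  | A_comp: "f \<in> Aalg sc br \<Longrightarrow> g \<in> Aalg sc br \<Longrightarrow> f \<circ> g \<in> Aalg sc br"

inductive_set Malg :: "('r \<Rightarrow> 'a::ab_group_add \<Rightarrow> 'a) \<Rightarrow> ('a \<Rightarrow> 'a \<Rightarrow> 'a) \<Rightarrow> ('a \<Rightarrow> 'a) set"
  for sc br where
    M_id: "id \<in> Malg sc br"
  | M_ad: "ad br x \<in> Malg sc br"
  | M_zero: "(\<lambda>v. 0) \<in> Malg sc br"
  | M_add: "f \<in> Malg sc br \<Longrightarrow> g \<in> Malg sc br \<Longrightarrow> (\<lambda>v. f v + g v) \<in> Malg sc br"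
  | M_neg: "f \<in> Malg sc br \<Longrightarrow> (\<lambda>v. - f v) \<in> Malg sc br"
  | M_smult: "f \<in> Malg sc br \<Longrightarrow> (\<lambda>v. sc c (f v)) \<in> Malg sc br"
  | M_comp: "f \<in> Malg sc br \<Longrightarrow> g \<in> Malg sc br \<Longrightarrow> f \<circ> g \<in> Malg sc br"

definition A0 :: "('r \<Rightarrow> 'a::ab_group_add \<Rightarrow> 'a) \<Rightarrow> ('a \<Rightarrow> 'a \<Rightarrow> 'a) \<Rightarrow> 'a set \<Rightarrow> ('a \<Rightarrow> 'a) set" where
  "A0 sc br L = {\<mu> \<in> Aalg sc br. \<mu> ` L \<subseteq> L}"

definition EndR :: "('a::ab_group_add \<Rightarrow> 'a) ring" where
  "EndR = \<lparr>carrier = {f. \<forall>x y. f (x + y) = f x + f y},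
           monoid.mult = (\<circ>), one = id, zero = (\<lambda>v. 0), add = (\<lambda>f g v. f v + g v)\<rparr>"

section \<open>Associative rings (possibly without unit), inside an ambient ring S\<close>

definition semiprime_sub :: "('b, 'm) ring_scheme \<Rightarrow> 'b set \<Rightarrow> bool" where
  "semiprime_sub S X \<longleftrightarrow>
     (\<forall>I. I \<subseteq> X \<and> \<zero>\<^bsub>S\<^esub> \<in> I \<and> (\<forall>a\<in>I. \<forall>b\<in>I. a \<oplus>\<^bsub>S\<^esub> b \<in> I) \<and> (\<forall>a\<in>I. \<ominus>\<^bsub>S\<^esub> a \<in> I) \<and>
          (\<forall>a\<in>I. \<forall>r\<in>X. a \<otimes>\<^bsub>S\<^esub> r \<in> I \<and> r \<otimes>\<^bsub>S\<^esub> a \<in> I) \<and> I \<noteq> {\<zero>\<^bsub>S\<^esub>}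
        \<longrightarrow> (\<exists>a\<in>I. \<exists>b\<in>I. a \<otimes>\<^bsub>S\<^esub> b \<noteq> \<zero>\<^bsub>S\<^esub>))"

definition dense_right_ideal :: "('b, 'm) ring_scheme \<Rightarrow> 'b set \<Rightarrow> 'b set \<Rightarrow> bool" where
  "dense_right_ideal S R I \<longleftrightarrow>
     I \<subseteq> R \<and> \<zero>\<^bsub>S\<^esub> \<in> I \<and> (\<forall>a\<in>I. \<forall>b\<in>I. a \<oplus>\<^bsub>S\<^esub> b \<in> I) \<and> (\<forall>a\<in>I. \<ominus>\<^bsub>S\<^esub> a \<in> I) \<and>
     (\<forall>a\<in>I. \<forall>r\<in>R. a \<otimes>\<^bsub>S\<^esub> r \<in> I) \<and>
     (\<forall>r1\<in>R. \<forall>r2\<in>R. r1 \<noteq> \<zero>\<^bsub>S\<^esub> \<longrightarrow> (\<exists>r\<in>R. r1 \<otimes>\<^bsub>S\<^esub> r \<noteq> \<zero>\<^bsub>S\<^esub> \<and> r2 \<otimes>\<^bsub>S\<^esub> r \<in> I))"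

definition dense_left_ideal :: "('b, 'm) ring_scheme \<Rightarrow> 'b set \<Rightarrow> 'b set \<Rightarrow> bool" where
  "dense_left_ideal S R I \<longleftrightarrow>
     I \<subseteq> R \<and> \<zero>\<^bsub>S\<^esub> \<in> I \<and> (\<forall>a\<in>I. \<forall>b\<in>I. a \<oplus>\<^bsub>S\<^esub> b \<in> I) \<and> (\<forall>a\<in>I. \<ominus>\<^bsub>S\<^esub> a \<in> I) \<and>
     (\<forall>a\<in>I. \<forall>r\<in>R. r \<otimes>\<^bsub>S\<^esub> a \<in> I) \<and>
     (\<forall>r1\<in>R. \<forall>r2\<in>R. r1 \<noteq> \<zero>\<^bsub>S\<^esub> \<longrightarrow> (\<exists>r\<in>R. r \<otimes>\<^bsub>S\<^esub> r1 \<noteq> \<zero>\<^bsub>S\<^esub> \<and> r \<otimes>\<^bsub>S\<^esub> r2 \<in> I))"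

text \<open>The unital ring S (containing R as a subring) is the maximal symmetric ring of
  quotients Q_sigma(R) of the semiprime ring R (Lanning's characterization).\<close>
definition is_Qsigma :: "('b, 'm) ring_scheme \<Rightarrow> 'b set \<Rightarrow> bool" where
  "is_Qsigma S R \<longleftrightarrow>
     R \<subseteq> carrier S \<and>
     (\<forall>q\<in>carrier S. \<exists>J K. dense_left_ideal S R J \<and> dense_right_ideal S R K \<and>
          (\<forall>x\<in>J. x \<otimes>\<^bsub>S\<^esub> q \<in> R) \<and> (\<forall>y\<in>K. q \<otimes>\<^bsub>S\<^esub> y \<in> R)) \<and>
     (\<forall>q\<in>carrier S.
          ((\<exists>J. dense_left_ideal S R J \<and> (\<forall>x\<in>J. x \<otimes>\<^bsub>S\<^esub> q = \<zero>\<^bsub>S\<^esub>)) \<or>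
           (\<exists>K. dense_right_ideal S R K \<and> (\<forall>y\<in>K. q \<otimes>\<^bsub>S\<^esub> y = \<zero>\<^bsub>S\<^esub>))) \<longrightarrow> q = \<zero>\<^bsub>S\<^esub>) \<and>
     (\<forall>J K f g. dense_left_ideal S R J \<and> dense_right_ideal S R K \<and>
          f ` K \<subseteq> R \<and> g ` J \<subseteq> R \<and>
          (\<forall>y1\<in>K. \<forall>y2\<in>K. f (y1 \<oplus>\<^bsub>S\<^esub> y2) = f y1 \<oplus>\<^bsub>S\<^esub> f y2) \<and>
          (\<forall>y\<in>K. \<forall>r\<in>R. f (y \<otimes>\<^bsub>S\<^esub> r) = f y \<otimes>\<^bsub>S\<^esub> r) \<and>
          (\<forall>x1\<in>J. \<forall>x2\<in>J. g (x1 \<oplus>\<^bsub>S\<^esub> x2) = g x1 \<oplus>\<^bsub>S\<^esub> g x2) \<and>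
          (\<forall>x\<in>J. \<forall>r\<in>R. g (r \<otimes>\<^bsub>S\<^esub> x) = r \<otimes>\<^bsub>S\<^esub> g x) \<and>
          (\<forall>x\<in>J. \<forall>y\<in>K. x \<otimes>\<^bsub>S\<^esub> f y = g x \<otimes>\<^bsub>S\<^esub> y)
        \<longrightarrow> (\<exists>q\<in>carrier S. (\<forall>y\<in>K. f y = q \<otimes>\<^bsub>S\<^esub> y) \<and> (\<forall>x\<in>J. g x = x \<otimes>\<^bsub>S\<^esub> q)))"

definition dense_ext :: "('r \<Rightarrow> 'a::ab_group_add \<Rightarrow> 'a) \<Rightarrow> ('a \<Rightarrow> 'a \<Rightarrow> 'a) \<Rightarrow> 'a set \<Rightarrow> bool" where
  "dense_ext sc br L \<longleftrightarrow> (\<forall>\<mu>\<in>Malg sc br. (\<forall>x\<in>L. \<mu> x = 0) \<longrightarrow> \<mu> = (\<lambda>v. 0))"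

definition mult_semiprime :: "('r \<Rightarrow> 'a::ab_group_add \<Rightarrow> 'a) \<Rightarrow> ('a \<Rightarrow> 'a \<Rightarrow> 'a) \<Rightarrow> bool" where
  "mult_semiprime sc br \<longleftrightarrow> lie_semiprime sc br UNIV \<and> semiprime_sub EndR (Malg sc br)"

definition alg_of_quotients :: "('r \<Rightarrow> 'a::ab_group_add \<Rightarrow> 'a) \<Rightarrow> ('a \<Rightarrow> 'a \<Rightarrow> 'a) \<Rightarrow> 'a set \<Rightarrow> bool" where
  "alg_of_quotients sc br L \<longleftrightarrow>
     (\<forall>q. q \<noteq> 0 \<longrightarrow> (\<exists>J. lie_ideal sc br L J \<and> {a\<in>L. \<forall>j\<in>J. br a j = 0} = {0} \<and>
          (\<exists>j\<in>J. br j q \<noteq> 0) \<and> (\<forall>j\<in>J. br j q \<in> L)))"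

end

theory Submission
  imports Defs
begin

text \<open>
  Density of \<open>L\<close> in \<open>Q\<close> lets multilinear operator identities pass from \<open>L\<close> to \<open>Q\<close>: a Lie
  monomial is, in each of its variables, the value of an element of \<open>M(Q)\<close>. Hence
  \<open>\<mu> A\<^sub>0 \<mu> = 0\<close> forces \<open>\<mu> A(Q) \<mu> = 0\<close>, so \<open>A\<^sub>0\<close> is semiprime. Likewise, if \<open>\<mu> ad\<^sub>x = 0\<close> for all \<open>x\<close>
  in an ideal \<open>J\<close> of \<open>L\<close> with zero annihilator, then \<open>\<mu> M(Q) ad\<^sub>x = 0\<close>, so \<open>ad\<^sub>x \<mu> = 0\<close> by
  semiprimeness of \<open>M(Q)\<close>, and \<open>\<mu> = 0\<close> because \<open>Ann\<^sub>Q(J) = 0\<close>. Ideals with zero annihilator are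
  therefore stable under brackets, and for \<open>\<mu>\<close> in \<open>A(Q)\<close> one finds such a \<open>J\<close> so small that
  \<open>\<mu> ad\<^sub>x\<close> and \<open>ad\<^sub>x \<mu>\<close> lie in \<open>A\<^sub>0\<close> for \<open>x\<close> in \<open>J\<close>. Thus \<open>A(Q)\<close> is a left and right quotient
  ring of \<open>A\<^sub>0\<close> in the sense of Utumi, and such an extension has the same maximal symmetric ring of
  quotients.
\<close>

section \<open>Symmetric quotient rings\<close>

text \<open>Subrings in the sense of rings without unit: \<open>A(Q)\<close> and \<open>A0\<close>
  need not contain the identity map.\<close>

definition subrng :: "('b, 'm) ring_scheme \<Rightarrow> 'b set \<Rightarrow> bool" where
  "subrng S X \<longleftrightarrow> X \<subseteq> carrier S \<and> \<zero>\<^bsub>S\<^esub> \<in> X \<and> (\<forall>a\<in>X. \<ominus>\<^bsub>S\<^esub> a \<in> X) \<and>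
     (\<forall>a\<in>X. \<forall>b\<in>X. a \<oplus>\<^bsub>S\<^esub> b \<in> X \<and> a \<otimes>\<^bsub>S\<^esub> b \<in> X)"

text \<open>Left-handed facts are obtained by reading right-handed ones in the opposite
  ring.\<close>

definition opp :: "('b, 'm) ring_scheme \<Rightarrow> ('b, 'm) ring_scheme" where
  "opp S = S\<lparr>monoid.mult := \<lambda>x y. y \<otimes>\<^bsub>S\<^esub> x\<rparr>"

lemma opp_simps [simp]:
  "carrier (opp S) = carrier S" "x \<otimes>\<^bsub>opp S\<^esub> y = y \<otimes>\<^bsub>S\<^esub> x" "x \<oplus>\<^bsub>opp S\<^esub> y = x \<oplus>\<^bsub>S\<^esub> y"
  "\<zero>\<^bsub>opp S\<^esub> = \<zero>\<^bsub>S\<^esub>" "\<one>\<^bsub>opp S\<^esub> = \<one>\<^bsub>S\<^esub>" "\<ominus>\<^bsub>opp S\<^esub> x = \<ominus>\<^bsub>S\<^esub> x"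
  by (simp_all add: opp_def a_inv_def)

lemma (in ring) ring_opp: "ring (opp R)"
proof (rule ringI)
  show "abelian_group (opp R)"
    by (rule abelian_groupI) (auto simp: a_ac intro: l_neg)
  show "monoid (opp R)"
    by (rule monoidI) (auto simp: m_assoc)
qed (auto simp: l_distr r_distr)

lemma subrng_opp [simp]: "subrng (opp S) X \<longleftrightarrow> subrng S X"
  by (auto simp: subrng_def)

lemma dense_left_ideal_opp: "dense_left_ideal S R = dense_right_ideal (opp S) R"
  by (auto simp: dense_left_ideal_def dense_right_ideal_def fun_eq_iff)

text \<open>Right quotient rings in the sense of Utumi.\<close>

locale right_quotient_ring = ring S for S (structure) +
  fixes R T
  assumes subrng_R: "subrng S R" and subrng_T: "subrng S T" and R_subset_T: "R \<subseteq> T"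
    and absorb: "\<lbrakk>t1 \<in> T; t1 \<noteq> \<zero>; t2 \<in> T\<rbrakk> \<Longrightarrow> \<exists>r\<in>R. t1 \<otimes> r \<noteq> \<zero> \<and> t2 \<otimes> r \<in> R"
begin

section \<open>Dense right ideals in a right quotient ring\<close>

lemma R_closed:
  "\<zero> \<in> R" "x \<in> R \<Longrightarrow> \<ominus> x \<in> R" "x \<in> R \<Longrightarrow> y \<in> R \<Longrightarrow> x \<oplus> y \<in> R" "x \<in> R \<Longrightarrow> y \<in> R \<Longrightarrow> x \<otimes> y \<in> R"
  using subrng_R by (auto simp: subrng_def)

lemma T_closed:
  "\<zero> \<in> T" "x \<in> T \<Longrightarrow> \<ominus> x \<in> T" "x \<in> T \<Longrightarrow> y \<in> T \<Longrightarrow> x \<oplus> y \<in> T" "x \<in> T \<Longrightarrow> y \<in> T \<Longrightarrow> x \<otimes> y \<in> T"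
  using subrng_T by (auto simp: subrng_def)

lemma R_T: "x \<in> R \<Longrightarrow> x \<in> T"
  using R_subset_T by auto

lemma T_carrier: "x \<in> T \<Longrightarrow> x \<in> carrier S"
  using subrng_T by (auto simp: subrng_def)

text \<open>Absorption is applied twice: after \<open>r\<close> has moved \<open>t2\<close> into
  \<open>R\<close>, the product \<open>t1 \<otimes> r\<close> is still nonzero and serves as first
  argument when \<open>t3 \<otimes> r\<close> is absorbed.\<close>

lemma absorb2:
  assumes "t1 \<in> T" "t1 \<noteq> \<zero>" "t2 \<in> T" "t3 \<in> T"
  shows "\<exists>r\<in>R. t1 \<otimes> r \<noteq> \<zero> \<and> t2 \<otimes> r \<in> R \<and> t3 \<otimes> r \<in> R"
proof -
  obtain r where r: "r \<in> R" "t1 \<otimes> r \<noteq> \<zero>" "t2 \<otimes> r \<in> R" using absorb assms by blast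
  obtain s where s: "s \<in> R" "(t1 \<otimes> r) \<otimes> s \<noteq> \<zero>" "(t3 \<otimes> r) \<otimes> s \<in> R"
    using absorb[OF T_closed(4)[OF assms(1) R_T] r(2) T_closed(4)[OF assms(4) R_T]] r(1) by blast
  have "t \<otimes> (r \<otimes> s) = (t \<otimes> r) \<otimes> s" if "t \<in> T" for t
    using that r s R_T T_carrier by (simp add: m_assoc)
  then show ?thesis using r s assms R_closed by (intro bexI[of _ "r \<otimes> s"]) auto
qed

text \<open>Density of \<open>K\<close> only tests elements of \<open>R\<close>, so
  \<open>t1\<close> and \<open>t2\<close> are first multiplied into \<open>R\<close> by a common
  \<open>s\<close> that keeps \<open>t1 \<otimes> s\<close> nonzero.\<close>

lemma dense_absorb:
  assumes K: "dense_right_ideal S R K" and t: "t1 \<in> T" "t1 \<noteq> \<zero>" "t2 \<in> T"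
  shows "\<exists>r\<in>R. t1 \<otimes> r \<noteq> \<zero> \<and> t2 \<otimes> r \<in> K"
proof -
  obtain s where s: "s \<in> R" "t1 \<otimes> s \<noteq> \<zero>" "t1 \<otimes> s \<in> R" "t2 \<otimes> s \<in> R"
    using absorb2[of t1 t1 t2] t by blast
  obtain r where r: "r \<in> R" "(t1 \<otimes> s) \<otimes> r \<noteq> \<zero>" "(t2 \<otimes> s) \<otimes> r \<in> K"
    using K s unfolding dense_right_ideal_def by blast
  have "t \<otimes> (s \<otimes> r) = (t \<otimes> s) \<otimes> r" if "t \<in> T" for t
    using that r s R_T T_carrier by (simp add: m_assoc)
  then show ?thesis using r s t R_closed by (intro bexI[of _ "s \<otimes> r"]) auto
qed

text \<open>Ascent from \<open>R\<close> to \<open>T\<close>: the multiplier found by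
  \<open>dense_absorb\<close> lies in \<open>R\<close>, hence in \<open>T\<close>, and carries
  \<open>r2\<close> into \<open>K\<close>, hence into \<open>X\<close>.\<close>

lemma dense_extend:
  assumes K: "dense_right_ideal S R K" and "K \<subseteq> X" and "X \<subseteq> T"
    and "\<And>a b. a \<in> X \<Longrightarrow> b \<in> X \<Longrightarrow> a \<oplus> b \<in> X" "\<And>a. a \<in> X \<Longrightarrow> \<ominus> a \<in> X"
    and "\<And>a t. a \<in> X \<Longrightarrow> t \<in> T \<Longrightarrow> a \<otimes> t \<in> X"
  shows "dense_right_ideal S T X"
proof -
  have "\<zero> \<in> X" using K assms(2) by (auto simp: dense_right_ideal_def)
  moreover have "\<exists>r\<in>T. r1 \<otimes> r \<noteq> \<zero> \<and> r2 \<otimes> r \<in> X" if "r1 \<in> T" "r2 \<in> T" "r1 \<noteq> \<zero>" for r1 r2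
    using dense_absorb[OF K that(1,3,2)] assms(2) R_T by blast
  ultimately show ?thesis
    unfolding dense_right_ideal_def by (simp add: assms(3-6))
qed

text \<open>Descent from \<open>T\<close> to \<open>R\<close>, also controlling the values of a
  \<open>T\<close>-linear map \<open>f\<close>. Different choices of \<open>f\<close> give the
  restriction of ideals, of multipliers and of partial homomorphisms.\<close>

lemma dense_restrict:
  assumes K: "dense_right_ideal S T K" and fK: "\<And>y. y \<in> K \<Longrightarrow> f y \<in> T"
    and add: "\<And>y z. y \<in> K \<Longrightarrow> z \<in> K \<Longrightarrow> f (y \<oplus> z) = f y \<oplus> f z"
    and mul: "\<And>y t. y \<in> K \<Longrightarrow> t \<in> T \<Longrightarrow> f (y \<otimes> t) = f y \<otimes> t"
  shows "dense_right_ideal S R {y \<in> K \<inter> R. f y \<in> R}"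
proof -
  have K0: "\<zero> \<in> K" "\<And>a b. a \<in> K \<Longrightarrow> b \<in> K \<Longrightarrow> a \<oplus> b \<in> K" "\<And>a. a \<in> K \<Longrightarrow> \<ominus> a \<in> K"
      "\<And>a t. a \<in> K \<Longrightarrow> t \<in> T \<Longrightarrow> a \<otimes> t \<in> K" "K \<subseteq> T"
    using K by (auto simp: dense_right_ideal_def)
  have f0: "f \<zero> = \<zero>"
    using mul[OF K0(1) T_closed(1)] fK[OF K0(1)] T_carrier by simp
  have fneg: "f (\<ominus> y) = \<ominus> f y" if "y \<in> K" for y
  proof -
    have "f (\<ominus> y) \<oplus> f y = \<zero>"
      using add[OF K0(3)[OF that] that] that K0(5) T_carrier f0 by (simp add: l_neg subset_iff)
    then show ?thesis
      using minus_equality fK[OF that] fK[OF K0(3)[OF that]] T_carrier by metis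
  qed
  have "\<exists>r\<in>R. r1 \<otimes> r \<noteq> \<zero> \<and> r2 \<otimes> r \<in> {y \<in> K \<inter> R. f y \<in> R}"
    if r12: "r1 \<in> R" "r2 \<in> R" "r1 \<noteq> \<zero>" for r1 r2
  proof -
    obtain t where t: "t \<in> T" "r1 \<otimes> t \<noteq> \<zero>" "r2 \<otimes> t \<in> K"
      using K r12 R_T unfolding dense_right_ideal_def by blast
    \<comment> \<open>The multiplier \<open>t\<close> lies only in \<open>T\<close>; the factor
      \<open>r\<close> brings both \<open>t\<close> and the value \<open>f (r2 \<otimes> t)\<close>
      into \<open>R\<close>.\<close>
    obtain r where r: "r \<in> R" "(r1 \<otimes> t) \<otimes> r \<noteq> \<zero>" "t \<otimes> r \<in> R" "f (r2 \<otimes> t) \<otimes> r \<in> R"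
      using absorb2[OF T_closed(4)[OF R_T[OF r12(1)] t(1)] t(2,1) fK[OF t(3)]] by blast
    have assoc: "s \<otimes> (t \<otimes> r) = (s \<otimes> t) \<otimes> r" if "s \<in> R" for s
      using that r t R_T T_carrier by (simp add: m_assoc)
    have "f (r2 \<otimes> (t \<otimes> r)) \<in> R" using assoc mul[OF t(3)] r r12 R_T by simp
    moreover have "r2 \<otimes> (t \<otimes> r) \<in> K" using assoc K0(4)[OF t(3)] r r12 R_T by simp
    moreover have "r1 \<otimes> (t \<otimes> r) \<noteq> \<zero>" "r2 \<otimes> (t \<otimes> r) \<in> R"
      using r assoc[OF r12(1)] R_closed(4)[OF r12(2) r(3)] by simp_all
    ultimately show ?thesis using r(3) by blast
  qed
  moreover have "f (a \<otimes> r) \<in> R" "a \<otimes> r \<in> K" if "a \<in> K" "f a \<in> R" "r \<in> R" for a r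
    using mul K0(4) that R_closed(4) R_T by simp_all
  ultimately show ?thesis
    unfolding dense_right_ideal_def
    by (simp add: K0 R_closed f0 fneg add) blast
qed

text \<open>Absorbing \<open>y \<otimes> r2\<close> and \<open>s \<otimes> r2\<close> at once gives
  density. With \<open>s\<close> the value of a partial homomorphism at \<open>y\<close>, this is
  the ideal on which that value can be tested inside \<open>R\<close>.\<close>

lemma dense_residual:
  assumes "y \<in> T" "s \<in> T"
  shows "dense_right_ideal S R {r \<in> R. y \<otimes> r \<in> R \<and> s \<otimes> r \<in> R}"
proof -
  have "\<exists>r\<in>R. r1 \<otimes> r \<noteq> \<zero> \<and> r2 \<otimes> r \<in> {r \<in> R. y \<otimes> r \<in> R \<and> s \<otimes> r \<in> R}"
    if r12: "r1 \<in> R" "r2 \<in> R" "r1 \<noteq> \<zero>" for r1 r2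
  proof -
    obtain r where r: "r \<in> R" "r1 \<otimes> r \<noteq> \<zero>" "(y \<otimes> r2) \<otimes> r \<in> R" "(s \<otimes> r2) \<otimes> r \<in> R"
      using absorb2[OF R_T[OF r12(1)] r12(3) T_closed(4)[OF assms(1) R_T[OF r12(2)]]
          T_closed(4)[OF assms(2) R_T[OF r12(2)]]] by blast
    then show ?thesis
      using assms r12 R_T T_carrier R_closed by (intro bexI[of _ r]) (auto simp: m_assoc)
  qed
  moreover have "y \<otimes> \<ominus> a = \<ominus> (y \<otimes> a)" "s \<otimes> \<ominus> a = \<ominus> (s \<otimes> a)"
    "y \<otimes> (a \<oplus> b) = y \<otimes> a \<oplus> y \<otimes> b" "s \<otimes> (a \<oplus> b) = s \<otimes> a \<oplus> s \<otimes> b"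
    "y \<otimes> (a \<otimes> b) = (y \<otimes> a) \<otimes> b" "s \<otimes> (a \<otimes> b) = (s \<otimes> a) \<otimes> b" if "a \<in> R" "b \<in> R" for a b
    using that assms R_T T_carrier by (simp_all add: r_minus r_distr m_assoc)
  moreover have "y \<otimes> \<zero> = \<zero>" "s \<otimes> \<zero> = \<zero>" using assms T_carrier by simp_all
  ultimately show ?thesis
    unfolding dense_right_ideal_def using R_closed by auto
qed

section \<open>Multipliers, annihilators and partial homomorphisms over \<open>R\<close> and
  \<open>T\<close>\<close>

lemma right_multiplier_restrict:
  assumes "q \<in> carrier S" "dense_right_ideal S T K" "\<forall>y\<in>K. q \<otimes> y \<in> T"
  shows "\<exists>K. dense_right_ideal S R K \<and> (\<forall>y\<in>K. q \<otimes> y \<in> R)"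
proof -
  have "K \<subseteq> carrier S" using assms(2) T_carrier by (auto simp: dense_right_ideal_def)
  then have "dense_right_ideal S R {y \<in> K \<inter> R. q \<otimes> y \<in> R}"
    using assms T_carrier by (intro dense_restrict) (auto simp: r_distr m_assoc subset_iff)
  then show ?thesis by blast
qed

lemma right_multiplier_extend:
  assumes "q \<in> carrier S" "dense_right_ideal S R K" "\<forall>y\<in>K. q \<otimes> y \<in> R"
  shows "\<exists>K. dense_right_ideal S T K \<and> (\<forall>y\<in>K. q \<otimes> y \<in> T)"
proof -
  have "K \<subseteq> R" using assms(2) by (auto simp: dense_right_ideal_def)
  then have "dense_right_ideal S T {y \<in> T. q \<otimes> y \<in> T}"
    using assms T_carrier R_T T_closed
    by (intro dense_extend[OF assms(2)]) (auto simp: r_distr r_minus m_assoc[symmetric])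
  then show ?thesis by blast
qed

lemma right_annihilated_extend:
  assumes "q \<in> carrier S" "dense_right_ideal S R K" "\<forall>y\<in>K. q \<otimes> y = \<zero>"
  shows "\<exists>K. dense_right_ideal S T K \<and> (\<forall>y\<in>K. q \<otimes> y = \<zero>)"
proof -
  have "K \<subseteq> R" using assms(2) by (auto simp: dense_right_ideal_def)
  then have "dense_right_ideal S T {y \<in> T. q \<otimes> y = \<zero>}"
    using assms T_carrier R_T T_closed
    by (intro dense_extend[OF assms(2)]) (auto simp: r_distr r_minus m_assoc[symmetric])
  then show ?thesis by blast
qed

lemma right_annihilated_restrict:
  assumes "q \<in> carrier S" "dense_right_ideal S T K" "\<forall>y\<in>K. q \<otimes> y = \<zero>"
  shows "\<exists>K. dense_right_ideal S R K \<and> (\<forall>y\<in>K. q \<otimes> y = \<zero>)"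
proof -
  have "K \<subseteq> T" using assms(2) by (auto simp: dense_right_ideal_def)
  \<comment> \<open>The identity map serves as \<open>f\<close> in
    \<open>dense_restrict\<close>.\<close>
  then have "dense_right_ideal S R {y \<in> K \<inter> R. y \<in> R}"
    by (intro dense_restrict[OF assms(2)]) auto
  then show ?thesis using assms(3) by blast
qed

text \<open>The partner \<open>g\<close> determines the extension: the value at \<open>y\<close> is
  the unique \<open>s\<close> in \<open>T\<close> with
  \<open>x \<otimes> s = g x \<otimes> y\<close> for all \<open>x\<close> in \<open>J\<close>, and
  \<open>K'\<close> collects the \<open>y\<close> for which such an \<open>s\<close> exists.
  Uniqueness comes from \<open>faithful\<close> and makes the extension well defined, additive and
  \<open>T\<close>-linear, since sums and multiples of solutions are solutions.\<close>

lemma partial_hom_extend: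
  assumes K: "dense_right_ideal S R K" and J: "J \<subseteq> T"
    and f: "\<And>y. y \<in> K \<Longrightarrow> f y \<in> T" and g: "\<And>x. x \<in> J \<Longrightarrow> g x \<in> T"
    and compat: "\<And>x y. x \<in> J \<Longrightarrow> y \<in> K \<Longrightarrow> x \<otimes> f y = g x \<otimes> y"
    and faithful: "\<And>s. s \<in> T \<Longrightarrow> (\<And>x. x \<in> J \<Longrightarrow> x \<otimes> s = \<zero>) \<Longrightarrow> s = \<zero>"
  obtains K' f' where "dense_right_ideal S T K'" "K \<subseteq> K'" "f' ` K' \<subseteq> T"
    "\<forall>y1\<in>K'. \<forall>y2\<in>K'. f' (y1 \<oplus> y2) = f' y1 \<oplus> f' y2"
    "\<forall>y\<in>K'. \<forall>t\<in>T. f' (y \<otimes> t) = f' y \<otimes> t"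
    "\<forall>y\<in>K. f' y = f y" "\<forall>x\<in>J. \<forall>y\<in>K'. x \<otimes> f' y = g x \<otimes> y"
proof -
  define E where "E y s \<longleftrightarrow> s \<in> T \<and> (\<forall>x\<in>J. x \<otimes> s = g x \<otimes> y)" for y s
  define K' where "K' = {y \<in> T. \<exists>s. E y s}"
  define f' where "f' y = (SOME s. E y s)" for y
  have KT: "K \<subseteq> T" using K R_T by (auto simp: dense_right_ideal_def)
  have JC: "x \<in> carrier S" "g x \<in> carrier S" if "x \<in> J" for x
    using that J g T_carrier by auto
  have unique: "s = s'" if "E y s" "E y s'" for y s s'
  proof -
    have T: "s \<in> T" "s' \<in> T" using that by (auto simp: E_def)
    then have C: "s \<in> carrier S" "s' \<in> carrier S" using T_carrier by auto
    have "s \<oplus> \<ominus> s' = \<zero>"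
    proof (rule faithful)
      show "s \<oplus> \<ominus> s' \<in> T" using T T_closed by blast
      show "x \<otimes> (s \<oplus> \<ominus> s') = \<zero>" if x: "x \<in> J" for x
      proof -
        have "x \<otimes> s = x \<otimes> s'" using \<open>E y s\<close> \<open>E y s'\<close> x by (simp add: E_def)
        then show ?thesis using JC[OF x] C by (simp add: r_distr r_minus r_neg)
      qed
    qed
    then show ?thesis using C by (metis minus_equality minus_minus a_inv_closed)
  qed
  have E_f': "E y (f' y)" if "y \<in> K'" for y
    using that unfolding f'_def K'_def by (auto intro: someI)
  have f'_eq: "f' y = s" if "E y s" for y s
    using that unique unfolding f'_def by (metis someI)
  have E_f: "E y (f y)" if "y \<in> K" for y
    using that f compat by (auto simp: E_def)
  have E_add: "E (y1 \<oplus> y2) (s1 \<oplus> s2)" if "E y1 s1" "E y2 s2" "y1 \<in> T" "y2 \<in> T" for y1 y2 s1 s2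
  proof -
    have T: "s1 \<in> T" "s2 \<in> T" using that by (auto simp: E_def)
    then show ?thesis
      using that JC T_carrier T_closed(3) by (auto simp: E_def r_distr)
  qed
  have E_mul: "E (y \<otimes> t) (s \<otimes> t)" if "E y s" "y \<in> T" "t \<in> T" for y s t
  proof -
    have T: "s \<in> T" using that by (auto simp: E_def)
    then show ?thesis
      using that JC T_carrier T_closed(4) by (auto simp: E_def m_assoc[symmetric])
  qed
  have E_neg: "E (\<ominus> y) (\<ominus> s)" if "E y s" "y \<in> T" for y s
  proof -
    have T: "s \<in> T" using that by (auto simp: E_def)
    then show ?thesis
      using that JC T_carrier T_closed(2) by (auto simp: E_def r_minus)
  qed
  show ?thesis
  proof (rule that)
    show "K \<subseteq> K'" using E_f KT by (auto simp: K'_def)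
    then show "dense_right_ideal S T K'"
    proof (rule dense_extend[OF K])
      show "K' \<subseteq> T" by (auto simp: K'_def)
      show "a \<oplus> b \<in> K'" if "a \<in> K'" "b \<in> K'" for a b
        using that E_add T_closed(3) unfolding K'_def by blast
      show "\<ominus> a \<in> K'" if "a \<in> K'" for a
        using that E_neg T_closed(2) unfolding K'_def by blast
      show "a \<otimes> t \<in> K'" if "a \<in> K'" "t \<in> T" for a t
        using that E_mul T_closed(4) unfolding K'_def by blast
    qed
    show "f' ` K' \<subseteq> T" using E_f' by (auto simp: E_def)
    show "\<forall>y1\<in>K'. \<forall>y2\<in>K'. f' (y1 \<oplus> y2) = f' y1 \<oplus> f' y2"
      using f'_eq E_add E_f' by (simp add: K'_def)
    show "\<forall>y\<in>K'. \<forall>t\<in>T. f' (y \<otimes> t) = f' y \<otimes> t"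
      using f'_eq E_mul E_f' by (simp add: K'_def)
    show "\<forall>y\<in>K. f' y = f y" using f'_eq E_f by blast
    show "\<forall>x\<in>J. \<forall>y\<in>K'. x \<otimes> f' y = g x \<otimes> y" using E_f' by (auto simp: E_def)
  qed
qed

end

section \<open>Invariance of the maximal symmetric ring of quotients\<close>

locale symmetric_quotient_ring = right_quotient_ring +
  assumes opp: "right_quotient_ring (opp S) R T"
begin

text \<open>The rewrites turn each fact about the opposite ring into a left-handed fact about
  \<open>S\<close>, available under the prefix \<open>l\<close>.\<close>

sublocale l: right_quotient_ring "opp S" R T
  rewrites "dense_right_ideal (opp S) = dense_left_ideal S"
    and "carrier (opp S) = carrier S" and "\<And>x y. x \<otimes>\<^bsub>opp S\<^esub> y = y \<otimes> x"
    and "\<And>x y. x \<oplus>\<^bsub>opp S\<^esub> y = x \<oplus> y" and "\<zero>\<^bsub>opp S\<^esub> = \<zero>" and "\<And>x. \<ominus>\<^bsub>opp S\<^esub> x = \<ominus> x"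
  using opp by (auto simp: dense_left_ideal_opp fun_eq_iff)

text \<open>The multiplier and annihilator conditions descend by the preceding lemmas. A compatible
  pair over \<open>R\<close> is extended to \<open>T\<close>, each map by means of the other, and
  the element of \<open>S\<close> realizing the extended pair realizes the original one.\<close>

lemma is_Qsigma_restrict:
  assumes Q: "is_Qsigma S T"
  shows "is_Qsigma S R"
proof -
  have mult: "\<exists>J K. dense_left_ideal S T J \<and> dense_right_ideal S T K \<and>
          (\<forall>x\<in>J. x \<otimes> q \<in> T) \<and> (\<forall>y\<in>K. q \<otimes> y \<in> T)" if "q \<in> carrier S" for q
    using Q that unfolding is_Qsigma_def by blast
  have ann_l: "q = \<zero>" if "q \<in> carrier S" "dense_left_ideal S T J" "\<forall>x\<in>J. x \<otimes> q = \<zero>" for q J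
    using Q that unfolding is_Qsigma_def by blast
  have ann_r: "q = \<zero>" if "q \<in> carrier S" "dense_right_ideal S T J" "\<forall>x\<in>J. q \<otimes> x = \<zero>" for q J
    using Q that unfolding is_Qsigma_def by blast
  have ann_l': "q = \<zero>" if "q \<in> carrier S" "dense_left_ideal S R J" "\<forall>x\<in>J. x \<otimes> q = \<zero>" for q J
    using l.right_annihilated_extend[OF that] ann_l[OF that(1)] by blast
  have ann_r': "q = \<zero>" if "q \<in> carrier S" "dense_right_ideal S R K" "\<forall>x\<in>K. q \<otimes> x = \<zero>" for q K
    using right_annihilated_extend[OF that] ann_r[OF that(1)] by blast
  have mult': "\<exists>J K. dense_left_ideal S R J \<and> dense_right_ideal S R K \<and>
          (\<forall>x\<in>J. x \<otimes> q \<in> R) \<and> (\<forall>y\<in>K. q \<otimes> y \<in> R)" if "q \<in> carrier S" for q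
    using mult[OF that] right_multiplier_restrict[OF that] l.right_multiplier_restrict[OF that]
    by meson
  have real: "\<exists>q\<in>carrier S. (\<forall>y\<in>K. f y = q \<otimes> y) \<and> (\<forall>x\<in>J. g x = x \<otimes> q)"
    if J: "dense_left_ideal S R J" and K: "dense_right_ideal S R K"
      and f: "f ` K \<subseteq> R" and g: "g ` J \<subseteq> R"
      and compat: "\<forall>x\<in>J. \<forall>y\<in>K. x \<otimes> f y = g x \<otimes> y"
    for J K f g
  proof -
    have sub: "J \<subseteq> T" "K \<subseteq> T"
      using J K R_T by (auto simp: dense_left_ideal_def dense_right_ideal_def)
    have fT: "f y \<in> T" if "y \<in> K" for y using f that R_T by blast
    have gT: "g x \<in> T" if "x \<in> J" for x using g that R_T by blast
    obtain K' f' where K': "dense_right_ideal S T K'" "K \<subseteq> K'" "f' ` K' \<subseteq> T"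
      "\<forall>y1\<in>K'. \<forall>y2\<in>K'. f' (y1 \<oplus> y2) = f' y1 \<oplus> f' y2"
      "\<forall>y\<in>K'. \<forall>t\<in>T. f' (y \<otimes> t) = f' y \<otimes> t" "\<forall>y\<in>K. f' y = f y"
    proof (rule partial_hom_extend[OF K sub(1) fT gT])
      show "x \<otimes> f y = g x \<otimes> y" if "x \<in> J" "y \<in> K" for x y using compat that by blast
      show "s = \<zero>" if "s \<in> T" "\<And>x. x \<in> J \<Longrightarrow> x \<otimes> s = \<zero>" for s
        using ann_l'[OF T_carrier J] that by blast
    qed
    obtain J' g' where J': "dense_left_ideal S T J'" "J \<subseteq> J'" "g' ` J' \<subseteq> T"
      "\<forall>x1\<in>J'. \<forall>x2\<in>J'. g' (x1 \<oplus> x2) = g' x1 \<oplus> g' x2"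
      "\<forall>x\<in>J'. \<forall>t\<in>T. g' (t \<otimes> x) = t \<otimes> g' x" "\<forall>x\<in>J. g' x = g x"
      "\<forall>y\<in>K. \<forall>x\<in>J'. g' x \<otimes> y = x \<otimes> f y"
    proof (rule l.partial_hom_extend[OF J sub(2) gT fT])
      show "g x \<otimes> y = x \<otimes> f y" if "y \<in> K" "x \<in> J" for x y using compat that by simp
      show "s = \<zero>" if "s \<in> T" "\<And>x. x \<in> K \<Longrightarrow> s \<otimes> x = \<zero>" for s
        using ann_r'[OF T_carrier K] that by blast
    qed
    \<comment> \<open>So far \<open>f'\<close> is known to match \<open>g\<close> and
      \<open>g'\<close> to match \<open>f\<close>, but not \<open>f'\<close> to match
      \<open>g'\<close>. A nonzero difference would survive multiplication by some \<open>r\<close>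
      with \<open>y \<otimes> r\<close> in \<open>K\<close>, where \<open>f'\<close> agrees with
      \<open>f\<close> and the compatibility of \<open>g'\<close> with \<open>f\<close> makes it
      zero.\<close>
    have "x \<otimes> f' y = g' x \<otimes> y" if x: "x \<in> J'" and y: "y \<in> K'" for x y
    proof (rule ccontr)
      assume "x \<otimes> f' y \<noteq> g' x \<otimes> y"
      have T: "x \<in> T" "y \<in> T" "f' y \<in> T" "g' x \<in> T"
        using x y J' K' by (auto simp: dense_left_ideal_def dense_right_ideal_def)
      note C = T[THEN T_carrier]
      let ?d = "x \<otimes> f' y \<oplus> \<ominus> (g' x \<otimes> y)"
      have "?d \<noteq> \<zero>"
        using \<open>x \<otimes> f' y \<noteq> g' x \<otimes> y\<close> C by (metis minus_equality minus_minus a_inv_closed m_closed)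
      then obtain r where r: "r \<in> R" "?d \<otimes> r \<noteq> \<zero>" "y \<otimes> r \<in> K"
        using dense_absorb[OF K T_closed(3)[OF T_closed(4)[OF T(1,3)]
              T_closed(2)[OF T_closed(4)[OF T(4,2)]]] _ T(2)] by blast
      have rC: "r \<in> carrier S" using r R_T T_carrier by blast
      have "f' y \<otimes> r = f (y \<otimes> r)" using K'(5,6) r R_T y by metis
      then have "x \<otimes> (f' y \<otimes> r) = g' x \<otimes> (y \<otimes> r)" using J'(7) r x by simp
      then have "?d \<otimes> r = \<zero>" using C rC by (simp add: l_distr l_minus m_assoc r_neg)
      then show False using r by simp
    qed
    then have "\<exists>q\<in>carrier S. (\<forall>y\<in>K'. f' y = q \<otimes> y) \<and> (\<forall>x\<in>J'. g' x = x \<otimes> q)"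
      using Q[unfolded is_Qsigma_def, THEN conjunct2, THEN conjunct2, THEN conjunct2,
          rule_format, of J' K' f' g'] J'(1,3-5) K'(1,3-5) by simp
    then show ?thesis using J'(2,6) K'(2,6) by (metis subsetD)
  qed
  show ?thesis
    unfolding is_Qsigma_def
  proof (intro conjI ballI allI impI)
    show "R \<subseteq> carrier S" using R_T T_carrier by blast
  next
    fix q assume "q \<in> carrier S"
    then show "\<exists>J K. dense_left_ideal S R J \<and> dense_right_ideal S R K \<and>
          (\<forall>x\<in>J. x \<otimes> q \<in> R) \<and> (\<forall>y\<in>K. q \<otimes> y \<in> R)" by (rule mult')
  next
    fix q assume "q \<in> carrier S" "(\<exists>J. dense_left_ideal S R J \<and> (\<forall>x\<in>J. x \<otimes> q = \<zero>)) \<or>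
           (\<exists>K. dense_right_ideal S R K \<and> (\<forall>y\<in>K. q \<otimes> y = \<zero>))"
    then show "q = \<zero>" using ann_l' ann_r' by blast
  next
    fix J K f g
    assume "dense_left_ideal S R J \<and> dense_right_ideal S R K \<and>
          f ` K \<subseteq> R \<and> g ` J \<subseteq> R \<and>
          (\<forall>y1\<in>K. \<forall>y2\<in>K. f (y1 \<oplus> y2) = f y1 \<oplus> f y2) \<and>
          (\<forall>y\<in>K. \<forall>r\<in>R. f (y \<otimes> r) = f y \<otimes> r) \<and>
          (\<forall>x1\<in>J. \<forall>x2\<in>J. g (x1 \<oplus> x2) = g x1 \<oplus> g x2) \<and>
          (\<forall>x\<in>J. \<forall>r\<in>R. g (r \<otimes> x) = r \<otimes> g x) \<and>
          (\<forall>x\<in>J. \<forall>y\<in>K. x \<otimes> f y = g x \<otimes> y)"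
    then show "\<exists>q\<in>carrier S. (\<forall>y\<in>K. f y = q \<otimes> y) \<and> (\<forall>x\<in>J. g x = x \<otimes> q)"
      using real by simp
  qed
qed

text \<open>A compatible pair over \<open>T\<close> is cut down to dense ideals of \<open>R\<close>
  on which its values lie in \<open>R\<close>. The element \<open>q\<close> realizing the smaller
  pair also realizes the whole pair, because each error term is annihilated by a dense ideal of
  \<open>R\<close>.\<close>

lemma is_Qsigma_extend:
  assumes Q: "is_Qsigma S R"
  shows "is_Qsigma S T"
proof -
  have mult: "\<exists>J K. dense_left_ideal S R J \<and> dense_right_ideal S R K \<and>
          (\<forall>x\<in>J. x \<otimes> q \<in> R) \<and> (\<forall>y\<in>K. q \<otimes> y \<in> R)" if "q \<in> carrier S" for q
    using Q that unfolding is_Qsigma_def by blast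
  have ann_l: "q = \<zero>" if "q \<in> carrier S" "dense_left_ideal S R J" "\<forall>x\<in>J. x \<otimes> q = \<zero>" for q J
    using Q that unfolding is_Qsigma_def by blast
  have ann_r: "q = \<zero>" if "q \<in> carrier S" "dense_right_ideal S R J" "\<forall>x\<in>J. q \<otimes> x = \<zero>" for q J
    using Q that unfolding is_Qsigma_def by blast
  have diff: "a = b" if "a \<in> carrier S" "b \<in> carrier S" "a \<oplus> \<ominus> b = \<zero>" for a b
    using that by (metis minus_equality minus_minus a_inv_closed)
  show ?thesis
    unfolding is_Qsigma_def
  proof (intro conjI ballI allI impI)
    show "T \<subseteq> carrier S" using T_carrier by blast
  next
    fix q assume q: "q \<in> carrier S"
    show "\<exists>J K. dense_left_ideal S T J \<and> dense_right_ideal S T K \<and>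
          (\<forall>x\<in>J. x \<otimes> q \<in> T) \<and> (\<forall>y\<in>K. q \<otimes> y \<in> T)"
      using mult[OF q] right_multiplier_extend[OF q] l.right_multiplier_extend[OF q] by meson
  next
    fix q assume q: "q \<in> carrier S" and "(\<exists>J. dense_left_ideal S T J \<and> (\<forall>x\<in>J. x \<otimes> q = \<zero>)) \<or>
           (\<exists>K. dense_right_ideal S T K \<and> (\<forall>y\<in>K. q \<otimes> y = \<zero>))"
    then show "q = \<zero>"
      using ann_l[OF q] ann_r[OF q] right_annihilated_restrict[OF q]
        l.right_annihilated_restrict[OF q] by meson
  next
    fix J K f g
    assume "dense_left_ideal S T J \<and> dense_right_ideal S T K \<and>
          f ` K \<subseteq> T \<and> g ` J \<subseteq> T \<and>
          (\<forall>y1\<in>K. \<forall>y2\<in>K. f (y1 \<oplus> y2) = f y1 \<oplus> f y2) \<and>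
          (\<forall>y\<in>K. \<forall>r\<in>T. f (y \<otimes> r) = f y \<otimes> r) \<and>
          (\<forall>x1\<in>J. \<forall>x2\<in>J. g (x1 \<oplus> x2) = g x1 \<oplus> g x2) \<and>
          (\<forall>x\<in>J. \<forall>r\<in>T. g (r \<otimes> x) = r \<otimes> g x) \<and>
          (\<forall>x\<in>J. \<forall>y\<in>K. x \<otimes> f y = g x \<otimes> y)"
    then have J: "dense_left_ideal S T J" and K: "dense_right_ideal S T K"
      and fT: "\<And>y. y \<in> K \<Longrightarrow> f y \<in> T" and gT: "\<And>x. x \<in> J \<Longrightarrow> g x \<in> T"
      and f_add: "\<And>y z. y \<in> K \<Longrightarrow> z \<in> K \<Longrightarrow> f (y \<oplus> z) = f y \<oplus> f z"
      and f_mul: "\<And>y t. y \<in> K \<Longrightarrow> t \<in> T \<Longrightarrow> f (y \<otimes> t) = f y \<otimes> t"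
      and g_add: "\<And>y z. y \<in> J \<Longrightarrow> z \<in> J \<Longrightarrow> g (y \<oplus> z) = g y \<oplus> g z"
      and g_mul: "\<And>y t. y \<in> J \<Longrightarrow> t \<in> T \<Longrightarrow> g (t \<otimes> y) = t \<otimes> g y"
      and compat: "\<And>x y. x \<in> J \<Longrightarrow> y \<in> K \<Longrightarrow> x \<otimes> f y = g x \<otimes> y"
      by (simp_all add: image_subset_iff)
    define K' where "K' = {y \<in> K \<inter> R. f y \<in> R}"
    define J' where "J' = {x \<in> J \<inter> R. g x \<in> R}"
    have K': "dense_right_ideal S R K'"
      unfolding K'_def by (rule dense_restrict[OF K fT f_add f_mul])
    have J': "dense_left_ideal S R J'"
      unfolding J'_def by (rule l.dense_restrict[OF J gT g_add g_mul])
    have sub: "J \<subseteq> T" "K \<subseteq> T"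
      and K_mul: "\<And>a t. a \<in> K \<Longrightarrow> t \<in> T \<Longrightarrow> a \<otimes> t \<in> K"
      and J_mul: "\<And>a t. a \<in> J \<Longrightarrow> t \<in> T \<Longrightarrow> t \<otimes> a \<in> J"
      using J K by (auto simp: dense_left_ideal_def dense_right_ideal_def)
    have "\<exists>q\<in>carrier S. (\<forall>y\<in>K'. f y = q \<otimes> y) \<and> (\<forall>x\<in>J'. g x = x \<otimes> q)"
    proof (rule Q[unfolded is_Qsigma_def, THEN conjunct2, THEN conjunct2, THEN conjunct2,
          rule_format], intro conjI ballI)
      show "dense_left_ideal S R J'" "dense_right_ideal S R K'" by fact+
      show "f ` K' \<subseteq> R" "g ` J' \<subseteq> R" by (auto simp: K'_def J'_def)
    qed (auto simp: K'_def J'_def f_add f_mul g_add g_mul compat R_T)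
    then obtain q where q: "q \<in> carrier S"
      and fq: "\<And>y. y \<in> K' \<Longrightarrow> f y = q \<otimes> y" and gq: "\<And>x. x \<in> J' \<Longrightarrow> g x = x \<otimes> q" by blast
    have "f y = q \<otimes> y" if y: "y \<in> K" for y
    proof -
      have yT: "y \<in> T" using y sub by auto
      have C: "y \<in> carrier S" "f y \<in> carrier S" using yT fT[OF y] T_carrier by auto
      \<comment> \<open>For \<open>r\<close> in the residual ideal of \<open>y\<close> and
        \<open>f y\<close>, the product \<open>y \<otimes> r\<close> lies in \<open>K'\<close>,
        where \<open>f\<close> is already multiplication by \<open>q\<close>.\<close>
      have "(f y \<oplus> \<ominus> (q \<otimes> y)) \<otimes> r = \<zero>" if r: "r \<in> R" "y \<otimes> r \<in> R" "f y \<otimes> r \<in> R" for r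
      proof -
        have rT: "r \<in> T" "r \<in> carrier S" using r R_T T_carrier by auto
        have "f y \<otimes> r = q \<otimes> (y \<otimes> r)"
          using fq[of "y \<otimes> r"] f_mul[OF y rT(1)] K_mul[OF y rT(1)] r by (simp add: K'_def)
        then show ?thesis using C q rT by (simp add: l_distr l_minus m_assoc r_neg)
      qed
      then have "f y \<oplus> \<ominus> (q \<otimes> y) = \<zero>"
        using C q by (intro ann_r[OF _ dense_residual[OF yT fT[OF y]]]) auto
      then show ?thesis using diff C q by simp
    qed
    moreover have "g x = x \<otimes> q" if x: "x \<in> J" for x
    proof -
      have xT: "x \<in> T" using x sub by auto
      have C: "x \<in> carrier S" "g x \<in> carrier S" using xT gT[OF x] T_carrier by auto
      have "r \<otimes> (g x \<oplus> \<ominus> (x \<otimes> q)) = \<zero>" if r: "r \<in> R" "r \<otimes> x \<in> R" "r \<otimes> g x \<in> R" for r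
      proof -
        have rT: "r \<in> T" "r \<in> carrier S" using r R_T T_carrier by auto
        have "r \<otimes> g x = r \<otimes> x \<otimes> q"
          using gq[of "r \<otimes> x"] g_mul[OF x rT(1)] J_mul[OF x rT(1)] r by (simp add: J'_def)
        then show ?thesis using C q rT by (simp add: r_distr r_minus m_assoc r_neg)
      qed
      then have "g x \<oplus> \<ominus> (x \<otimes> q) = \<zero>"
        using C q by (intro ann_l[OF _ l.dense_residual[OF xT gT[OF x]]]) auto
      then show ?thesis using diff C q by simp
    qed
    ultimately show "\<exists>q\<in>carrier S. (\<forall>y\<in>K. f y = q \<otimes> y) \<and> (\<forall>x\<in>J. g x = x \<otimes> q)"
      using q by blast
  qed
qed

end

text \<open>Instead of the ideal generated by \<open>a\<close>, the proof uses the intersection of the right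
  annihilator of \<open>a X\<close> with its own left annihilator: an ideal of square zero containing \<open>a\<close>.\<close>

lemma (in ring) semiprime_subD:
  assumes sp: "semiprime_sub R X" and X: "subrng R X" "\<one> \<in> X" and a: "a \<in> X"
    and aXa: "\<And>r. r \<in> X \<Longrightarrow> a \<otimes> r \<otimes> a = \<zero>"
  shows "a = \<zero>"
proof (rule ccontr)
  assume "a \<noteq> \<zero>"
  define N where "N = {w \<in> X. \<forall>r\<in>X. a \<otimes> r \<otimes> w = \<zero>}"
  define I where "I = {z \<in> N. \<forall>w\<in>N. z \<otimes> w = \<zero>}"
  have XC: "x \<in> carrier R" if "x \<in> X" for x using X that by (auto simp: subrng_def)
  have cl: "\<zero> \<in> X" "x \<in> X \<Longrightarrow> \<ominus> x \<in> X" "x \<in> X \<Longrightarrow> y \<in> X \<Longrightarrow> x \<oplus> y \<in> X"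
    "x \<in> X \<Longrightarrow> y \<in> X \<Longrightarrow> x \<otimes> y \<in> X" for x y
    using X by (auto simp: subrng_def)
  have N_X: "w \<in> X" if "w \<in> N" for w using that by (simp add: N_def)
  have N_add: "w \<oplus> w' \<in> N" if "w \<in> N" "w' \<in> N" for w w'
    using that a by (auto simp: N_def cl XC r_distr)
  have N_neg: "\<ominus> w \<in> N" if "w \<in> N" for w
    using that a by (auto simp: N_def cl XC r_minus)
  have N_right: "w \<otimes> r \<in> N" if "w \<in> N" "r \<in> X" for w r
    using that a by (auto simp: N_def cl XC m_assoc[symmetric])
  have N_left: "r \<otimes> w \<in> N" if w: "w \<in> N" and r: "r \<in> X" for w r
  proof -
    have "a \<otimes> s \<otimes> (r \<otimes> w) = a \<otimes> (s \<otimes> r) \<otimes> w" if "s \<in> X" for s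
      using that w r a by (simp add: N_X XC m_assoc)
    then show ?thesis using w r by (auto simp: N_def cl)
  qed
  have "a \<in> N" using a aXa by (simp add: N_def)
  \<comment> \<open>The unit of \<open>X\<close> as middle factor turns \<open>a X w = 0\<close>
    into \<open>a w = 0\<close>, so \<open>a\<close> also annihilates \<open>N\<close> from the
    left.\<close>
  moreover have "a \<otimes> w = \<zero>" if "w \<in> N" for w
    using that X(2) a by (auto simp: N_def XC dest!: bspec[of _ _ \<one>])
  ultimately have "a \<in> I" by (simp add: I_def)
  then have "I \<noteq> {\<zero>}" using \<open>a \<noteq> \<zero>\<close> by blast
  moreover have "I \<subseteq> X" by (auto simp: I_def N_X)
  moreover have "\<zero> \<in> I" using a by (auto simp: I_def N_def cl XC)
  moreover have "x \<oplus> y \<in> I" if "x \<in> I" "y \<in> I" for x y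
    using that by (auto simp: I_def N_add N_X XC l_distr)
  moreover have "\<ominus> x \<in> I" if "x \<in> I" for x
    using that by (auto simp: I_def N_neg N_X XC l_minus)
  moreover have "x \<otimes> r \<in> I" if "x \<in> I" "r \<in> X" for x r
    using that by (auto simp: I_def N_right N_left N_X XC m_assoc)
  moreover have "r \<otimes> x \<in> I" if "x \<in> I" "r \<in> X" for x r
    using that by (auto simp: I_def N_right N_left N_X XC m_assoc)
  ultimately have "\<exists>x\<in>I. \<exists>y\<in>I. x \<otimes> y \<noteq> \<zero>"
    using sp[unfolded semiprime_sub_def, rule_format, of I] by simp
  then show False by (auto simp: I_def)
qed

section \<open>The ring of additive endomorphisms\<close>

lemma EndR_simps [simp]:
  "x \<in> carrier EndR \<longleftrightarrow> (\<forall>u v. x (u + v) = x u + x v)" "x \<otimes>\<^bsub>EndR\<^esub> y = x \<circ> y"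
  "x \<oplus>\<^bsub>EndR\<^esub> y = (\<lambda>v. x v + y v)" "\<zero>\<^bsub>EndR\<^esub> = (\<lambda>v. 0)" "\<one>\<^bsub>EndR\<^esub> = id"
  by (simp_all add: EndR_def)

lemma ring_EndR: "ring (EndR :: ('a::ab_group_add \<Rightarrow> 'a) ring)"
proof (rule ringI)
  show "abelian_group (EndR :: ('a \<Rightarrow> 'a) ring)"
  proof (rule abelian_groupI)
    fix x :: "'a \<Rightarrow> 'a" assume "x \<in> carrier EndR"
    then show "\<exists>y\<in>carrier EndR. y \<oplus>\<^bsub>EndR\<^esub> x = \<zero>\<^bsub>EndR\<^esub>"
      by (intro bexI[of _ "\<lambda>v. - x v"]) auto
  qed (auto simp: algebra_simps)
  show "monoid (EndR :: ('a \<Rightarrow> 'a) ring)" by (rule monoidI) (auto simp: comp_assoc)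
qed (auto simp: fun_eq_iff)

lemma EndR_a_inv: "x \<in> carrier EndR \<Longrightarrow> \<ominus>\<^bsub>EndR\<^esub> x = (\<lambda>v. - x v)"
  by (rule abelian_group.minus_equality[OF ring.is_abelian_group[OF ring_EndR]]) auto

section \<open>Dense extensions of Lie algebras\<close>

text \<open>The product \<open>[I, J]\<close>. For ideals the additive span is already closed under
  negatives and scalars, which move into the first factor.\<close>

inductive_set bracket_span :: "('a::ab_group_add \<Rightarrow> 'a \<Rightarrow> 'a) \<Rightarrow> 'a set \<Rightarrow> 'a set \<Rightarrow> 'a set"
  for br I J where
    bracket_span_zero: "0 \<in> bracket_span br I J"
  | bracket_span_base: "x \<in> I \<Longrightarrow> y \<in> J \<Longrightarrow> br x y \<in> bracket_span br I J"
  | bracket_span_add: "u \<in> bracket_span br I J \<Longrightarrow> v \<in> bracket_span br I J \<Longrightarrow> u + v \<in> bracket_span br I J"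

section \<open>Lie identities and multiplication operators\<close>

locale lie_algebra =
  fixes sc :: "'r::comm_ring_1 \<Rightarrow> 'a::ab_group_add \<Rightarrow> 'a" and br :: "'a \<Rightarrow> 'a \<Rightarrow> 'a"
  assumes lie_alg: "lie_alg sc br"
begin

lemma sc_add: "sc c (x + y) = sc c x + sc c y"
  and sc_mult: "sc (c * d) x = sc c (sc d x)"
  and br_add: "br (x + y) z = br x z + br y z" "br x (y + z) = br x y + br x z"
  and br_sc: "br (sc c x) y = sc c (br x y)" "br x (sc c y) = sc c (br x y)"
  and br_self: "br x x = 0"
  and jacobi_cyclic: "br x (br y z) + br y (br z x) + br z (br x y) = 0"
  using lie_alg by (simp_all add: lie_alg_def)

lemma sc_0: "sc c 0 = 0"
  using sc_add[of c 0 0] by simp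

lemma br_0: "br 0 x = 0" "br x 0 = 0"
  using br_add(1)[of 0 0 x] br_add(2)[of x 0 0] by simp_all

lemma br_minus: "br (- x) y = - br x y" "br x (- y) = - br x y"
  using br_add(1)[of x "- x" y] br_add(2)[of x y "- y"]
  by (simp_all add: br_0 eq_neg_iff_add_eq_0 add.commute)

lemma br_anti: "br x y = - br y x"
proof -
  have "br x y + br y x = 0"
    using br_self[of "x + y", unfolded br_add] by (simp add: br_self[of x] br_self[of y] add.commute)
  then show ?thesis by (simp add: eq_neg_iff_add_eq_0)
qed

lemma jacobi: "br x (br y z) = br (br x y) z + br y (br x z)"
  using jacobi_cyclic[of x y z] br_anti[of z "br x y"] br_anti[of z x]
  by (simp add: br_minus algebra_simps)

lemma Malg_linear:
  assumes "f \<in> Malg sc br"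
  shows "f (x + y) = f x + f y" "f (sc c x) = sc c (f x)"
proof -
  have sc_sc: "sc c (sc d x) = sc d (sc c x)" for c d x
    by (simp flip: sc_mult add: mult.commute)
  have sc_minus: "sc c (- x) = - sc c x" for c x
    using sc_add[of c x "- x"] by (simp add: sc_0 eq_neg_iff_add_eq_0 add.commute)
  show "f (x + y) = f x + f y"
    using assms by (induction arbitrary: x y) (simp_all add: ad_def br_add sc_add)
  show "f (sc c x) = sc c (f x)"
    using assms by (induction arbitrary: x) (simp_all add: ad_def br_sc sc_add sc_0 sc_minus sc_sc[of c])
qed

lemma Malg_0: "f \<in> Malg sc br \<Longrightarrow> f 0 = 0"
  using Malg_linear(1)[of f 0 0] by simp

lemma Malg_minus: "f \<in> Malg sc br \<Longrightarrow> f (- x) = - f x"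
  using Malg_linear(1)[of f x "- x"] by (simp add: Malg_0 eq_neg_iff_add_eq_0 add.commute)

lemma Aalg_Malg: "f \<in> Aalg sc br \<Longrightarrow> f \<in> Malg sc br"
  by (induction rule: Aalg.induct) (rule Malg.intros; assumption)+

text \<open>\<open>A(Q)\<close> is a left ideal of \<open>M(Q)\<close>; this lets a factor from
  \<open>M(Q)\<close> followed by some \<open>ad\<close> be treated as an element of
  \<open>A(Q)\<close>.\<close>

lemma Malg_comp_Aalg:
  assumes "f \<in> Malg sc br" "g \<in> Aalg sc br"
  shows "f \<circ> g \<in> Aalg sc br"
  using assms
proof (induction arbitrary: g)
  case M_id
  then show ?case by simp
next
  case (M_ad x)
  then show ?case by (intro A_comp A_ad)
next
  case M_zero
  show ?case using A_zero by (simp add: comp_def)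
next
  case (M_add f h)
  then have "(\<lambda>v. (f \<circ> g) v + (h \<circ> g) v) \<in> Aalg sc br" by (intro A_add) auto
  then show ?case by (simp add: comp_def)
next
  case (M_neg f)
  then have "(\<lambda>v. - (f \<circ> g) v) \<in> Aalg sc br" by (intro A_neg) auto
  then show ?case by (simp add: comp_def)
next
  case (M_smult f c)
  then have "(\<lambda>v. sc c ((f \<circ> g) v)) \<in> Aalg sc br" by (intro A_smult) auto
  then show ?case by (simp add: comp_def)
next
  case (M_comp f h)
  then show ?case by (simp add: comp_assoc)
qed

end

locale dense_quotient_extension = lie_algebra sc br
  for sc :: "'r::comm_ring_1 \<Rightarrow> 'a::ab_group_add \<Rightarrow> 'a" and br :: "'a \<Rightarrow> 'a \<Rightarrow> 'a" +
  fixes L :: "'a set"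
  assumes subalg: "lie_subalg sc br L" and dense: "dense_ext sc br L"
    and msp: "mult_semiprime sc br" and quotients: "alg_of_quotients sc br L"
begin

section \<open>Ideals with zero annihilator\<close>

abbreviation "M \<equiv> Malg sc br"
abbreviation "A \<equiv> Aalg sc br"

text \<open>In a semiprime Lie algebra the ideals with zero annihilator are exactly the essential
  ones.\<close>

definition essential :: "'a set \<Rightarrow> bool" where
  "essential J \<longleftrightarrow> lie_ideal sc br L J \<and> (\<forall>a\<in>L. (\<forall>j\<in>J. br a j = 0) \<longrightarrow> a = 0)"

lemma L_closed: "0 \<in> L" "x \<in> L \<Longrightarrow> y \<in> L \<Longrightarrow> x + y \<in> L" "x \<in> L \<Longrightarrow> - x \<in> L"
  "x \<in> L \<Longrightarrow> sc c x \<in> L" "x \<in> L \<Longrightarrow> y \<in> L \<Longrightarrow> br x y \<in> L"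
  using subalg by (auto simp: lie_subalg_def)

lemma essential_closed:
  assumes "essential J"
  shows "x \<in> J \<Longrightarrow> x \<in> L" "0 \<in> J" "x \<in> J \<Longrightarrow> y \<in> J \<Longrightarrow> x + y \<in> J" "x \<in> J \<Longrightarrow> - x \<in> J"
    "x \<in> J \<Longrightarrow> sc c x \<in> J" "a \<in> L \<Longrightarrow> x \<in> J \<Longrightarrow> br a x \<in> J" "a \<in> L \<Longrightarrow> x \<in> J \<Longrightarrow> br x a \<in> J"
proof -
  show "a \<in> L \<Longrightarrow> x \<in> J \<Longrightarrow> br x a \<in> J"
    using assms br_anti[of x a] by (simp add: essential_def lie_ideal_def)
qed (use assms in \<open>auto simp: essential_def lie_ideal_def\<close>)

lemma vanish_on_L: "f \<in> M \<Longrightarrow> (\<And>x. x \<in> L \<Longrightarrow> f x = 0) \<Longrightarrow> f v = 0"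
  using dense by (auto simp: dense_ext_def dest!: bspec)

lemma ex_absorbing_essential:
  assumes "q \<noteq> 0"
  obtains J where "essential J" "\<exists>j\<in>J. br j q \<noteq> 0" "\<And>j. j \<in> J \<Longrightarrow> br q j \<in> L"
proof -
  obtain J where J: "lie_ideal sc br L J" "{a\<in>L. \<forall>j\<in>J. br a j = 0} = {0}"
    "\<exists>j\<in>J. br j q \<noteq> 0" "\<forall>j\<in>J. br j q \<in> L"
    using quotients assms unfolding alg_of_quotients_def by blast
  show ?thesis
  proof
    show "essential J" using J(1,2) unfolding essential_def by blast
    show "br q j \<in> L" if "j \<in> J" for j using J(4) that br_anti[of q j] L_closed(3) by simp
  qed (use J in blast)
qed

text \<open>Lifts the zero annihilator from \<open>L\<close> to \<open>Q\<close>. If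
  \<open>q\<close> commutes with \<open>J\<close>, so does each \<open>[q, k]\<close> with
  \<open>k\<close> in \<open>L\<close>, by Jacobi. For \<open>k\<close> in an ideal \<open>K\<close>
  absorbing \<open>q\<close> these brackets lie in \<open>L\<close>, so they vanish, whereas
  \<open>[K, q]\<close> is nonzero for nonzero \<open>q\<close>.\<close>

lemma essential_annihilator:
  assumes J: "essential J" and "\<And>j. j \<in> J \<Longrightarrow> br j q = 0"
  shows "q = 0"
proof (rule ccontr)
  assume "q \<noteq> 0"
  then obtain K where K: "essential K" "\<exists>k\<in>K. br k q \<noteq> 0" "\<And>k. k \<in> K \<Longrightarrow> br q k \<in> L"
    using ex_absorbing_essential by metis
  have "br q k = 0" if k: "k \<in> K" for k
  proof -
    have "br (br q k) j = 0" if j: "j \<in> J" for j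
    proof -
      have "br k j \<in> J" using j k essential_closed(6)[OF J essential_closed(1)[OF K(1)]] by blast
      then have "br q (br k j) = 0" "br q j = 0"
        using assms(2) j br_anti[of q] by simp_all
      then show ?thesis using jacobi[of q k j] by (simp add: br_0)
    qed
    then show ?thesis using J K(3)[OF k] by (auto simp: essential_def)
  qed
  then show False using K(2) br_anti[of _ q] by auto
qed

lemma essential_L: "essential L"
proof -
  have "a = 0" if "a \<in> L" "\<forall>j\<in>L. br a j = 0" for a
  proof (rule ccontr)
    assume "a \<noteq> 0"
    then obtain J where J: "essential J" "\<exists>j\<in>J. br j a \<noteq> 0"
      by (rule ex_absorbing_essential)
    then show False using that essential_closed(1)[OF J(1)] br_anti[of _ a] by auto
  qed
  then show ?thesis using L_closed by (auto simp: essential_def lie_ideal_def)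
qed

lemma subrng_M: "subrng EndR M"
proof -
  have C: "f \<in> carrier EndR" if "f \<in> M" for f
    using Malg_linear(1)[OF that] by simp
  have "\<ominus>\<^bsub>EndR\<^esub> f \<in> M" if "f \<in> M" for f
    using M_neg[OF that] EndR_a_inv[OF C[OF that]] by simp
  then show ?thesis
    using C M_zero M_add M_comp by (auto simp: subrng_def simp del: EndR_simps(1) simp flip: comp_def)
qed

lemma M_semiprimeD:
  assumes "f \<in> M" "\<And>g v. g \<in> M \<Longrightarrow> f (g (f v)) = 0"
  shows "f v = 0"
proof -
  have "f = \<zero>\<^bsub>EndR\<^esub>"
  proof (rule ring.semiprime_subD[OF ring_EndR])
    show "semiprime_sub EndR M" using msp by (simp add: mult_semiprime_def)
  qed (use assms subrng_M M_id in \<open>auto simp: fun_eq_iff\<close>)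
  then show ?thesis by simp
qed

text \<open>By density, vanishing of \<open>f [[x, v], l]\<close> for all \<open>l\<close> in \<open>L\<close> entails its vanishing for all
  \<open>l\<close> in \<open>Q\<close>; so the operators vanishing on \<open>[J, Q]\<close> form a right ideal of \<open>M(Q)\<close>.\<close>

lemma vanish_on_essential_bracket:
  assumes J: "essential J" and f: "f \<in> M" and fJ: "\<And>x v. x \<in> J \<Longrightarrow> f (br x v) = 0"
  shows "f v = 0"
proof -
  have step: "f (br q (br x v)) = 0"
    if f: "f \<in> M" and fJ: "\<And>x v. x \<in> J \<Longrightarrow> f (br x v) = 0" and x: "x \<in> J" for f q x v
  proof -
    \<comment> \<open>By Jacobi this splits into the values at \<open>[[l, x], v]\<close> and
      \<open>[x, [l, v]]\<close>; both vanish, as \<open>[l, x]\<close> lies in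
      \<open>J\<close>.\<close>
    have "f (br l (br x v)) = 0" if l: "l \<in> L" for l
      using fJ[OF essential_closed(6)[OF J l x], of v] fJ[OF x, of "br l v"]
      by (simp add: jacobi[of l x v] Malg_linear[OF f])
    then have "(f \<circ> ad br (br x v)) l = 0" if "l \<in> L" for l
      using that br_anti[of "br x v" l] by (simp add: ad_def Malg_minus[OF f])
    then have "(f \<circ> ad br (br x v)) q = 0"
      using vanish_on_L[OF M_comp[OF f M_ad]] by blast
    then show ?thesis
      using br_anti[of q "br x v"] by (simp add: ad_def Malg_minus[OF f])
  qed
  \<comment> \<open>The induction on \<open>g\<close> keeps \<open>f\<close> arbitrary: for a
    composition, \<open>f \<circ> g\<close> takes over the role of \<open>f\<close>.\<close>
  have "f (g (br x v)) = 0"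
    if "g \<in> M" "f \<in> M" "\<And>x v. x \<in> J \<Longrightarrow> f (br x v) = 0" "x \<in> J" for f g x v
    using that
  proof (induction arbitrary: f x v)
    case (M_ad q)
    then show ?case using step by (simp add: ad_def)
  next
    case (M_comp g h)
    have fg: "f \<circ> g \<in> M" using M_comp.prems(1) M_comp.hyps(1) by (rule Malg.M_comp)
    have "(f \<circ> g) (h (br x v)) = 0"
      using M_comp.IH(2)[OF fg _ M_comp.prems(3)] M_comp.IH(1)[OF M_comp.prems(1,2)] by simp
    then show ?case by simp
  next
    case (M_add g h)
    show ?case
      using M_add.IH(1)[OF M_add.prems] M_add.IH(2)[OF M_add.prems]
      by (simp add: Malg_linear[OF M_add.prems(1)])
  next
    case (M_smult g c)
    show ?case
      using M_smult.IH[OF M_smult.prems] by (simp add: Malg_linear[OF M_smult.prems(1)] sc_0)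
  qed (simp_all add: Malg_0 Malg_minus)
  then have fgx: "f (g (br x v)) = 0" if "g \<in> M" "x \<in> J" for g x v
    using f fJ that by blast
  \<comment> \<open>From \<open>f g ad_x = 0\<close> for all \<open>g\<close> in \<open>M(Q)\<close>
    it follows that \<open>(ad_x f) g (ad_x f) = 0\<close>, so semiprimeness applies.\<close>
  have "br x (f v) = 0" if x: "x \<in> J" for x
  proof -
    have "(ad br x \<circ> f) v = 0"
    proof (rule M_semiprimeD[where f = "ad br x \<circ> f"])
      show "ad br x \<circ> f \<in> M" using f by (intro M_comp M_ad)
      show "(ad br x \<circ> f) (g ((ad br x \<circ> f) v)) = 0" if "g \<in> M" for g v
        using fgx[OF that x] by (simp add: ad_def br_0)
    qed
    then show ?thesis by (simp add: ad_def)
  qed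
  then show ?thesis by (rule essential_annihilator[OF J])
qed

lemma bracket_span_subset:
  assumes "essential I" "essential J" "z \<in> bracket_span br I J"
  shows "z \<in> I" "z \<in> J"
proof -
  have "z \<in> I \<and> z \<in> J"
    using assms(3)
  proof induction
    case (bracket_span_base x y)
    then show ?case
      using essential_closed(1,6,7)[OF assms(1)] essential_closed(1,6,7)[OF assms(2)] by blast
  qed (auto simp: essential_closed[OF assms(1)] essential_closed[OF assms(2)])
  then show "z \<in> I" "z \<in> J" by auto
qed

text \<open>If \<open>a\<close> annihilates \<open>[I, J]\<close>, then
  \<open>ad_a ad_x ad_y\<close> vanishes on \<open>L\<close>, because \<open>[y, l]\<close> lies in
  \<open>J\<close>, and by density on \<open>Q\<close>. The factors \<open>ad_y\<close> and then
  \<open>ad_x\<close> are cancelled by \<open>vanish_on_essential_bracket\<close>, leaving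
  \<open>ad_a = 0\<close>.\<close>

lemma essential_bracket_span:
  assumes I: "essential I" and J: "essential J"
  shows "essential (bracket_span br I J)"
proof -
  let ?P = "bracket_span br I J"
  have "- z \<in> ?P \<and> sc c z \<in> ?P \<and> (\<forall>a\<in>L. br a z \<in> ?P)" if "z \<in> ?P" for z c
    using that
  proof induction
    case bracket_span_zero
    show ?case using bracket_span.bracket_span_zero[of br I J] by (simp add: sc_0 br_0)
  next
    case (bracket_span_base x y)
    have "- br x y \<in> ?P"
      using bracket_span.bracket_span_base[OF essential_closed(4)[OF I bracket_span_base(1)]
          bracket_span_base(2)] by (metis br_minus(1))
    moreover have "sc c (br x y) \<in> ?P"
      using bracket_span.bracket_span_base[OF essential_closed(5)[OF I bracket_span_base(1)]
          bracket_span_base(2)] by (metis br_sc(1))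
    moreover have "br a (br x y) \<in> ?P" if "a \<in> L" for a
      unfolding jacobi[of a x y]
      using that bracket_span_base essential_closed(6)[OF I] essential_closed(6)[OF J]
      by (blast intro: bracket_span.intros)
    ultimately show ?case by blast
  next
    case (bracket_span_add u v)
    then show ?case
      using bracket_span.bracket_span_add[of "- u" br I J "- v"]
      by (auto simp: sc_add br_add intro: bracket_span.bracket_span_add)
  qed
  moreover have "?P \<subseteq> L"
    using bracket_span_subset(1)[OF I J] essential_closed(1)[OF I] by blast
  ultimately have "lie_ideal sc br L ?P"
    by (auto simp: lie_ideal_def intro: bracket_span.intros)
  moreover have "a = 0" if a: "a \<in> L" "\<forall>z\<in>?P. br a z = 0" for a
  proof -
    have "br a (br x (br y v)) = 0" if "x \<in> I" "y \<in> J" for x y v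
    proof -
      have "(ad br a \<circ> (ad br x \<circ> ad br y)) v = 0"
      proof (rule vanish_on_L[where f = "ad br a \<circ> (ad br x \<circ> ad br y)"])
        show "ad br a \<circ> (ad br x \<circ> ad br y) \<in> M" by (intro M_comp M_ad)
        show "(ad br a \<circ> (ad br x \<circ> ad br y)) l = 0" if "l \<in> L" for l
          using a \<open>x \<in> I\<close> essential_closed(7)[OF J that \<open>y \<in> J\<close>]
          by (auto simp: ad_def intro: bracket_span_base)
      qed
      then show ?thesis by (simp add: ad_def)
    qed
    then have "(ad br a \<circ> ad br x) v = 0" if "x \<in> I" for x v
      using that vanish_on_essential_bracket[OF J M_comp[OF M_ad M_ad], of a x v]
      by (simp add: ad_def)
    then have "ad br a v = 0" for v
      using vanish_on_essential_bracket[OF I M_ad, of a v] by (simp add: ad_def)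
    then show ?thesis using I a(1) by (simp add: ad_def essential_def)
  qed
  ultimately show ?thesis by (auto simp: essential_def)
qed

lemma ex_common_essential:
  assumes "essential I" "essential J"
  obtains K where "essential K" "K \<subseteq> I" "K \<subseteq> J"
  using essential_bracket_span[OF assms] bracket_span_subset[OF assms] by blast

text \<open>Operators of \<open>M(Q)\<close> are continuous at zero when the essential ideals are
  taken as neighbourhoods of zero.\<close>

lemma ex_essential_into:
  assumes "f \<in> M" "essential I"
  shows "\<exists>J. essential J \<and> (\<forall>x\<in>J. f x \<in> I)"
  using assms
proof (induction arbitrary: I)
  case (M_ad q)
  show ?case
  proof (cases "q = 0")
    case True
    then show ?thesis
      using M_ad essential_closed(2)[OF M_ad] by (auto simp: ad_def br_0)
  next
    case False
    then obtain K0 where K0: "essential K0" "\<And>j. j \<in> K0 \<Longrightarrow> br q j \<in> L"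
      using ex_absorbing_essential by metis
    obtain K where K: "essential K" "K \<subseteq> K0" "K \<subseteq> I"
      using ex_common_essential[OF K0(1) M_ad] by blast
    \<comment> \<open>Only \<open>[q, K] \<subseteq> L\<close> is known. On \<open>[K, K]\<close>
      the derivation rule pairs each \<open>[q, x]\<close> in \<open>L\<close> with an element of
      \<open>K\<close>, so the result falls back into \<open>K\<close>.\<close>
    have "br q z \<in> K" if "z \<in> bracket_span br K K" for z
      using that
    proof induction
      case (bracket_span_base x y)
      then show ?case
        using K K0(2) unfolding jacobi[of q x y]
        by (blast intro: essential_closed(3,6,7)[OF K(1)])
    qed (simp_all add: br_0 br_add essential_closed[OF K(1)])
    then show ?thesis
      using K essential_bracket_span[OF K(1) K(1)] by (auto simp: ad_def)
  qed
next
  case (M_add f g)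
  obtain J where J: "essential J" "\<forall>x\<in>J. f x \<in> I" using M_add.IH(1)[OF M_add.prems] by blast
  obtain K where K: "essential K" "\<forall>x\<in>K. g x \<in> I" using M_add.IH(2)[OF M_add.prems] by blast
  obtain N where "essential N" "N \<subseteq> J" "N \<subseteq> K" using ex_common_essential[OF J(1) K(1)] by blast
  then show ?case using J K essential_closed(3)[OF M_add.prems] by blast
next
  case (M_comp f g)
  then show ?case unfolding comp_def by meson
qed (auto simp: essential_closed, (metis essential_closed)+)

definition bounded :: "'a set \<Rightarrow> bool" where
  "bounded V \<longleftrightarrow> (\<forall>I. essential I \<longrightarrow> (\<exists>J. essential J \<and> (\<forall>x\<in>J. \<forall>v\<in>V. br x v \<in> I)))"

lemma bounded_image:
  assumes "f \<in> M" "bounded V"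
  shows "bounded (f ` V)"
  using assms
proof (induction arbitrary: V)
  case (M_ad q)
  show ?case
    unfolding bounded_def
  proof (intro allI impI)
    fix I assume I: "essential I"
    \<comment> \<open>The ideals are chosen for
      \<open>[x, [q, v]] = [[x, q], v] + [q, [x, v]]\<close>: \<open>J3\<close> and
      \<open>J2\<close> control the first summand, \<open>J1\<close> and \<open>I1\<close> the
      second.\<close>
    obtain I1 where I1: "essential I1" "\<And>x. x \<in> I1 \<Longrightarrow> br q x \<in> I"
      using ex_essential_into[OF Malg.M_ad[of br q sc] I] by (auto simp: ad_def)
    obtain J1 where J1: "essential J1" "\<And>x v. x \<in> J1 \<Longrightarrow> v \<in> V \<Longrightarrow> br x v \<in> I1"
      using M_ad I1(1) unfolding bounded_def by blast
    obtain J2 where J2: "essential J2" "\<And>x v. x \<in> J2 \<Longrightarrow> v \<in> V \<Longrightarrow> br x v \<in> I"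
      using M_ad I unfolding bounded_def by blast
    obtain J3 where J3: "essential J3" "\<And>x. x \<in> J3 \<Longrightarrow> br q x \<in> J2"
      using ex_essential_into[OF Malg.M_ad[of br q sc] J2(1)] by (auto simp: ad_def)
    obtain J where J: "essential J" "J \<subseteq> J1" "J \<subseteq> J3"
      using ex_common_essential[OF J1(1) J3(1)] by blast
    have "br x (br q v) \<in> I" if "x \<in> J" "v \<in> V" for x v
    proof -
      have "br x q \<in> J2"
        using that J J3 essential_closed(4)[OF J2(1)] br_anti[of x q] by auto
      then show ?thesis
        unfolding jacobi[of x q v]
        using that J J1 I1 J2 essential_closed(3)[OF I] by blast
    qed
    then show "\<exists>J. essential J \<and> (\<forall>x\<in>J. \<forall>v\<in>ad br q ` V. br x v \<in> I)"
      using J(1) by (auto simp: ad_def)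
  qed
next
  case (M_add f g)
  show ?case
    unfolding bounded_def
  proof (intro allI impI)
    fix I assume I: "essential I"
    obtain J1 where J1: "essential J1" "\<forall>x\<in>J1. \<forall>v\<in>f ` V. br x v \<in> I"
      using M_add.IH(1)[OF M_add.prems] I unfolding bounded_def by blast
    obtain J2 where J2: "essential J2" "\<forall>x\<in>J2. \<forall>v\<in>g ` V. br x v \<in> I"
      using M_add.IH(2)[OF M_add.prems] I unfolding bounded_def by blast
    obtain J where "essential J" "J \<subseteq> J1" "J \<subseteq> J2"
      using ex_common_essential[OF J1(1) J2(1)] by blast
    then show "\<exists>J. essential J \<and> (\<forall>x\<in>J. \<forall>v\<in>(\<lambda>v. f v + g v) ` V. br x v \<in> I)"
      using J1 J2 essential_closed(3)[OF I] by (intro exI[of _ J]) (simp add: br_add subset_iff)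
  qed
next
  case M_zero
  show ?case
    unfolding bounded_def by (auto simp: br_0 essential_closed(2))
next
  case (M_neg f)
  then have "bounded (f ` V)" by blast
  then show ?case
    unfolding bounded_def by (simp add: br_minus) (meson essential_closed(4))
next
  case (M_smult f c)
  then have "bounded (f ` V)" by blast
  then show ?case
    unfolding bounded_def by (simp add: br_sc) (meson essential_closed(5))
next
  case (M_comp f g)
  then have "bounded (f ` g ` V)" by blast
  then show ?case by (simp add: image_comp)
qed simp

lemma bounded_L: "bounded L"
  unfolding bounded_def using essential_closed(7) by blast

section \<open>\<open>A(Q)\<close> as a two-sided quotient ring of \<open>A0\<close>\<close>

lemma ad_A0: "x \<in> L \<Longrightarrow> ad br x \<in> A0 sc br L"
  using L_closed(5) by (auto simp: A0_def ad_def[of br x, symmetric] intro: A_ad) (simp add: ad_def)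

text \<open>The multiplier is \<open>ad_x\<close> with \<open>x\<close> in an essential
  \<open>J\<close> that \<open>g\<close> maps into \<open>L\<close>; then \<open>g ad_x\<close> maps
  \<open>L\<close> into \<open>g J\<close>. Not all \<open>f ad_x\<close> vanish, by
  \<open>vanish_on_essential_bracket\<close>.\<close>

lemma A0_right_quotient:
  assumes "f \<in> A" "f v \<noteq> 0" "g \<in> A"
  shows "\<exists>h\<in>A0 sc br L. f \<circ> h \<noteq> (\<lambda>v. 0) \<and> g \<circ> h \<in> A0 sc br L"
proof -
  obtain J where J: "essential J" "\<forall>x\<in>J. g x \<in> L"
    using ex_essential_into[OF Aalg_Malg[OF assms(3)] essential_L] by blast
  obtain x w where x: "x \<in> J" "f (br x w) \<noteq> 0"
    using vanish_on_essential_bracket[OF J(1) Aalg_Malg[OF assms(1)]] assms(2) by blast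
  have "g \<circ> ad br x \<in> A0 sc br L"
    using J x(1) assms(3) essential_closed(7)[OF J(1)]
    by (auto simp: A0_def intro: A_comp A_ad) (simp add: ad_def)
  moreover have "f \<circ> ad br x \<noteq> (\<lambda>v. 0)" using x(2) by (auto simp: ad_def fun_eq_iff)
  ultimately show ?thesis using ad_A0 x(1) essential_closed(1)[OF J(1)] by blast
qed

text \<open>Again the multiplier is some \<open>ad_x\<close>. Boundedness of the image of
  \<open>L\<close> under \<open>g\<close> gives an essential \<open>J\<close> with
  \<open>[J, g L] \<subseteq> L\<close>, and \<open>J\<close> has zero annihilator in
  \<open>Q\<close>.\<close>

lemma A0_left_quotient:
  assumes "f \<in> A" "f v \<noteq> 0" "g \<in> A"
  shows "\<exists>h\<in>A0 sc br L. h \<circ> f \<noteq> (\<lambda>v. 0) \<and> h \<circ> g \<in> A0 sc br L"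
proof -
  obtain J where J: "essential J" "\<forall>x\<in>J. \<forall>v\<in>g ` L. br x v \<in> L"
    using bounded_image[OF Aalg_Malg[OF assms(3)] bounded_L] essential_L
    unfolding bounded_def by blast
  obtain x where x: "x \<in> J" "br x (f v) \<noteq> 0"
    using essential_annihilator[OF J(1)] assms(2) by blast
  have "ad br x \<circ> g \<in> A0 sc br L"
    using J x(1) assms(3) by (auto simp: A0_def intro: A_comp A_ad) (simp add: ad_def)
  moreover have "ad br x \<circ> f \<noteq> (\<lambda>v. 0)" using x(2) by (auto simp: ad_def fun_eq_iff)
  ultimately show ?thesis using ad_A0 x(1) essential_closed(1)[OF J(1)] by blast
qed

text \<open>The middle factor is enlarged from \<open>A0\<close> to \<open>A(Q)\<close>, one
  \<open>ad\<close> at a time, by density. Then \<open>f A(Q) f = 0\<close>, and semiprimeness of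
  \<open>M(Q)\<close> gives \<open>ad_q f = 0\<close> for all \<open>q\<close>.\<close>

lemma A0_sandwich:
  assumes f: "f \<in> A0 sc br L" and fA0f: "\<And>h v. h \<in> A0 sc br L \<Longrightarrow> f (h (f v)) = 0"
  shows "f v = 0"
proof -
  have fA: "f \<in> A" using f by (simp add: A0_def)
  note fM = Aalg_Malg[OF fA]
  \<comment> \<open>With the identity adjoined, an \<open>ad\<close> standing directly before
    \<open>f\<close> is covered as well; \<open>ad_l\<close> brings each element of
    \<open>?H\<close> into \<open>A0\<close>.\<close>
  let ?H = "insert id (A0 sc br L)"
  have ad_H: "ad br l \<circ> h \<in> A0 sc br L" if "l \<in> L" "h \<in> ?H" for l h
    using that ad_A0[OF that(1)] by (auto simp: A0_def intro: A_comp)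
  \<comment> \<open>The left factor \<open>e\<close> stands for the part of a word already enlarged;
    \<open>Z\<close> passes from \<open>e\<close> to \<open>e \<circ> g\<close>, which drives the
    composition case.\<close>
  define Z where "Z e \<longleftrightarrow> e \<in> M \<and> (\<forall>h\<in>A0 sc br L. \<forall>v. e (h (f v)) = 0)" for e
  have step: "e (br q (h (f v))) = 0" if "Z e" and h: "h \<in> ?H" for e q h v
  proof -
    have e: "e \<in> M" and eA0: "\<And>h v. h \<in> A0 sc br L \<Longrightarrow> e (h (f v)) = 0"
      using \<open>Z e\<close> by (auto simp: Z_def)
    \<comment> \<open>Reversing the bracket makes the expression an operator of \<open>M(Q)\<close>
      in the variable \<open>l\<close>, so density can replace \<open>l\<close> by
      \<open>q\<close>.\<close>
    have "(e \<circ> ad br (h (f v))) l = 0" if "l \<in> L" for l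
      using eA0[OF ad_H[OF that h], of v] br_anti[of "h (f v)" l]
      by (simp add: ad_def Malg_minus[OF e])
    then have "(e \<circ> ad br (h (f v))) q = 0"
      using vanish_on_L[OF M_comp[OF e M_ad]] by blast
    then show ?thesis
      using br_anti[of q "h (f v)"] by (simp add: ad_def Malg_minus[OF e])
  qed
  have egf: "e (g (h (f v))) = 0" if "g \<in> A" "Z e" "h \<in> ?H" for e g h v
    using that
  proof (induction arbitrary: e h v)
    case (A_ad q)
    show ?case unfolding ad_def by (rule step[OF A_ad])
  next
    case (A_comp g g')
    have "e \<circ> g \<in> M"
      using A_comp.prems(1) Aalg_Malg[OF A_comp.hyps(1)] by (auto simp: Z_def intro: M_comp)
    then have "Z (e \<circ> g)"
      using A_comp.IH(1)[OF A_comp.prems(1)] by (simp add: Z_def)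
    then have "(e \<circ> g) (g' (h (f v))) = 0"
      using A_comp.prems(2) by (rule A_comp.IH(2))
    then show ?case by simp
  next
    case (A_add g g')
    then have "e \<in> M" by (simp add: Z_def)
    then show ?case
      using A_add.IH(1)[OF A_add.prems] A_add.IH(2)[OF A_add.prems] by (simp add: Malg_linear)
  next
    case (A_smult g c)
    then have "e \<in> M" by (simp add: Z_def)
    then show ?case using A_smult.IH[OF A_smult.prems] by (simp add: Malg_linear sc_0)
  qed (simp_all add: Z_def Malg_0 Malg_minus)
  have "Z f" using fM fA0f by (simp add: Z_def)
  have "br q (f v) = 0" for q
  proof -
    have "(ad br q \<circ> f) v = 0"
    proof (rule M_semiprimeD[where f = "ad br q \<circ> f"])
      show "ad br q \<circ> f \<in> M" by (intro M_comp M_ad fM)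
      show "(ad br q \<circ> f) (g ((ad br q \<circ> f) v)) = 0" if "g \<in> M" for g v
        using egf[OF Malg_comp_Aalg[OF that A_ad] \<open>Z f\<close>, of id q v] by (simp add: ad_def br_0)
    qed
    then show ?thesis by (simp add: ad_def)
  qed
  then show ?thesis using essential_annihilator[OF essential_L] by blast
qed

text \<open>In an ideal \<open>I\<close> with zero products, \<open>a \<circ> h\<close> and
  \<open>a\<close> both lie in \<open>I\<close>, so \<open>a h a = 0\<close> and
  \<open>A0_sandwich\<close> applies.\<close>

lemma semiprime_A0: "semiprime_sub EndR (A0 sc br L)"
  unfolding semiprime_sub_def
proof (intro allI impI, rule ccontr)
  fix I
  assume I: "I \<subseteq> A0 sc br L \<and> \<zero>\<^bsub>EndR\<^esub> \<in> I \<and> (\<forall>a\<in>I. \<forall>b\<in>I. a \<oplus>\<^bsub>EndR\<^esub> b \<in> I) \<and>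
    (\<forall>a\<in>I. \<ominus>\<^bsub>EndR\<^esub> a \<in> I) \<and>
    (\<forall>a\<in>I. \<forall>r\<in>A0 sc br L. a \<otimes>\<^bsub>EndR\<^esub> r \<in> I \<and> r \<otimes>\<^bsub>EndR\<^esub> a \<in> I) \<and> I \<noteq> {\<zero>\<^bsub>EndR\<^esub>}"
    and "\<not> (\<exists>a\<in>I. \<exists>b\<in>I. a \<otimes>\<^bsub>EndR\<^esub> b \<noteq> \<zero>\<^bsub>EndR\<^esub>)"
  then have sq: "a \<circ> b = (\<lambda>v. 0)" if "a \<in> I" "b \<in> I" for a b using that by auto
  have "a = (\<lambda>v. 0)" if a: "a \<in> I" for a
  proof
    fix v
    have "a (h (a w)) = 0" if "h \<in> A0 sc br L" for h w
    proof -
      have "a \<circ> h \<in> I" using I a that by auto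
      then show ?thesis using sq[OF _ a] by (metis comp_apply)
    qed
    moreover have "a \<in> A0 sc br L" using I a by auto
    ultimately show "a v = 0" using A0_sandwich by blast
  qed
  then show False using I by auto
qed

lemma A0_closed:
  "(\<lambda>v. 0) \<in> A0 sc br L"
  "f \<in> A0 sc br L \<Longrightarrow> (\<lambda>v. - f v) \<in> A0 sc br L"
  "f \<in> A0 sc br L \<Longrightarrow> g \<in> A0 sc br L \<Longrightarrow> (\<lambda>v. f v + g v) \<in> A0 sc br L"
  "f \<in> A0 sc br L \<Longrightarrow> g \<in> A0 sc br L \<Longrightarrow> f \<circ> g \<in> A0 sc br L"
  using L_closed by (auto simp: A0_def image_subset_iff intro: A_zero A_neg A_add A_comp)

end

section \<open>Transport along an embedding into an ambient ring\<close>

lemma symmetric_quotient_ring_image: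
  fixes S :: "('s, 'm) ring_scheme" and B A :: "('a::ab_group_add \<Rightarrow> 'a) set"
  assumes S: "ring S" and \<phi>C: "\<phi> ` A \<subseteq> carrier S" and inj: "inj_on \<phi> A"
    and hom: "\<forall>f\<in>A. \<forall>g\<in>A. \<phi> (\<lambda>v. f v + g v) = \<phi> f \<oplus>\<^bsub>S\<^esub> \<phi> g \<and> \<phi> (f \<circ> g) = \<phi> f \<otimes>\<^bsub>S\<^esub> \<phi> g"
    and closed: "\<And>Y f g. Y \<in> {B, A} \<Longrightarrow> f \<in> Y \<Longrightarrow> g \<in> Y \<Longrightarrow>
      (\<lambda>v. 0) \<in> Y \<and> (\<lambda>v. - f v) \<in> Y \<and> (\<lambda>v. f v + g v) \<in> Y \<and> f \<circ> g \<in> Y"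
    and zero: "(\<lambda>v. 0) \<in> B" and sub: "B \<subseteq> A"
    and right: "\<And>f g. f \<in> A \<Longrightarrow> g \<in> A \<Longrightarrow> f \<noteq> (\<lambda>v. 0) \<Longrightarrow>
      \<exists>h\<in>B. f \<circ> h \<noteq> (\<lambda>v. 0) \<and> g \<circ> h \<in> B"
    and left: "\<And>f g. f \<in> A \<Longrightarrow> g \<in> A \<Longrightarrow> f \<noteq> (\<lambda>v. 0) \<Longrightarrow>
      \<exists>h\<in>B. h \<circ> f \<noteq> (\<lambda>v. 0) \<and> h \<circ> g \<in> B"
  shows "symmetric_quotient_ring S (\<phi> ` B) (\<phi> ` A)"
proof -
  interpret ring S by fact
  have C: "\<phi> f \<in> carrier S" if "f \<in> A" for f using \<phi>C that by auto
  have zA: "(\<lambda>v. 0) \<in> A" using zero sub by auto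
  \<comment> \<open>The map \<open>\<phi>\<close> is given only as compatible with sums and
    products; cancellation in \<open>S\<close> yields zero and negatives.\<close>
  have \<phi>0: "\<phi> (\<lambda>v. 0) = \<zero>\<^bsub>S\<^esub>"
  proof -
    have "\<phi> (\<lambda>v. 0) = \<phi> (\<lambda>v. 0) \<oplus>\<^bsub>S\<^esub> \<phi> (\<lambda>v. 0)"
      using hom[rule_format, OF zA zA] by simp
    then show ?thesis using C[OF zA] by (metis add.l_cancel_one' )
  qed
  have neg: "\<phi> (\<lambda>v. - f v) = \<ominus>\<^bsub>S\<^esub> \<phi> f" if f: "f \<in> A" for f
  proof -
    have nf: "(\<lambda>v. - f v) \<in> A" using closed[of A f f] f by simp
    have "\<phi> (\<lambda>v. - f v) \<oplus>\<^bsub>S\<^esub> \<phi> f = \<zero>\<^bsub>S\<^esub>"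
      using hom[rule_format, OF nf f] \<phi>0 by simp
    then show ?thesis using minus_equality[OF _ C[OF f] C[OF nf]] by simp
  qed
  have nonzero: "\<phi> f \<noteq> \<zero>\<^bsub>S\<^esub> \<longleftrightarrow> f \<noteq> (\<lambda>v. 0)" if "f \<in> A" for f
    using inj_onD[OF inj _ that zA] \<phi>0 by auto
  have subrng: "subrng S (\<phi> ` Y)" if Y: "Y \<in> {B, A}" for Y
  proof -
    have BA: "f \<in> A" if "f \<in> Y" for f using Y that sub by auto
    have "\<zero>\<^bsub>S\<^esub> \<in> \<phi> ` Y" using Y zero zA \<phi>0 by (metis image_eqI insertE singletonD)
    moreover have "\<ominus>\<^bsub>S\<^esub> \<phi> f \<in> \<phi> ` Y" if "f \<in> Y" for f
      using closed[OF Y that that] neg[OF BA[OF that]] by (metis image_eqI)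
    moreover have "\<phi> f \<oplus>\<^bsub>S\<^esub> \<phi> g \<in> \<phi> ` Y \<and> \<phi> f \<otimes>\<^bsub>S\<^esub> \<phi> g \<in> \<phi> ` Y" if "f \<in> Y" "g \<in> Y" for f g
      using closed[OF Y that] hom[rule_format, OF BA BA, OF that] by (metis image_eqI)
    ultimately show ?thesis using C BA by (auto simp: subrng_def)
  qed
  have "\<exists>r\<in>\<phi> ` B. \<phi> f \<otimes>\<^bsub>S\<^esub> r \<noteq> \<zero>\<^bsub>S\<^esub> \<and> \<phi> g \<otimes>\<^bsub>S\<^esub> r \<in> \<phi> ` B"
    if fg: "f \<in> A" "g \<in> A" and nz: "\<phi> f \<noteq> \<zero>\<^bsub>S\<^esub>" for f g
  proof -
    obtain h where h: "h \<in> B" "f \<circ> h \<noteq> (\<lambda>v. 0)" "g \<circ> h \<in> B"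
      using right[OF fg] nz nonzero[OF fg(1)] by blast
    have hA: "h \<in> A" using h sub by auto
    have "f \<circ> h \<in> A" using closed[of A f h] fg hA by simp
    then have "\<phi> f \<otimes>\<^bsub>S\<^esub> \<phi> h \<noteq> \<zero>\<^bsub>S\<^esub>" "\<phi> g \<otimes>\<^bsub>S\<^esub> \<phi> h \<in> \<phi> ` B"
      using nonzero h hom[rule_format, OF fg(1) hA] hom[rule_format, OF fg(2) hA] by (metis, metis image_eqI)
    then show ?thesis using h(1) by blast
  qed
  moreover have "\<exists>r\<in>\<phi> ` B. r \<otimes>\<^bsub>S\<^esub> \<phi> f \<noteq> \<zero>\<^bsub>S\<^esub> \<and> r \<otimes>\<^bsub>S\<^esub> \<phi> g \<in> \<phi> ` B"
    if fg: "f \<in> A" "g \<in> A" and nz: "\<phi> f \<noteq> \<zero>\<^bsub>S\<^esub>" for f g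
  proof -
    obtain h where h: "h \<in> B" "h \<circ> f \<noteq> (\<lambda>v. 0)" "h \<circ> g \<in> B"
      using left[OF fg] nz nonzero[OF fg(1)] by blast
    have hA: "h \<in> A" using h sub by auto
    have "h \<circ> f \<in> A" using closed[of A h f] fg hA by simp
    then have "\<phi> h \<otimes>\<^bsub>S\<^esub> \<phi> f \<noteq> \<zero>\<^bsub>S\<^esub>" "\<phi> h \<otimes>\<^bsub>S\<^esub> \<phi> g \<in> \<phi> ` B"
      using nonzero h hom[rule_format, OF hA fg(1)] hom[rule_format, OF hA fg(2)] by (metis, metis image_eqI)
    then show ?thesis using h(1) by blast
  qed
  moreover have "subrng S (\<phi> ` B)" "subrng S (\<phi> ` A)" "\<phi> ` B \<subseteq> \<phi> ` A"
    using subrng sub by auto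
  ultimately show ?thesis
    using S ring_opp
    unfolding symmetric_quotient_ring_def symmetric_quotient_ring_axioms_def
      right_quotient_ring_def right_quotient_ring_axioms_def
    by (auto simp: image_iff)
qed

theorem mainTheorem19:
  fixes sc :: "'r::comm_ring_1 \<Rightarrow> 'a::ab_group_add \<Rightarrow> 'a"
    and br :: "'a \<Rightarrow> 'a \<Rightarrow> 'a"
    and L :: "'a set"
  assumes "lie_alg sc br"
    and "lie_subalg sc br L"
    and "dense_ext sc br L"
    and "mult_semiprime sc br"
    and "alg_of_quotients sc br L"
  shows "semiprime_sub EndR (A0 sc br L) \<and>
    (\<forall>(S :: ('s, 'm) ring_scheme) \<phi>.
        ring S \<and> \<phi> ` Aalg sc br \<subseteq> carrier S \<and> inj_on \<phi> (Aalg sc br) \<and>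
        (\<forall>f\<in>Aalg sc br. \<forall>g\<in>Aalg sc br.
            \<phi> (\<lambda>v. f v + g v) = \<phi> f \<oplus>\<^bsub>S\<^esub> \<phi> g \<and> \<phi> (f \<circ> g) = \<phi> f \<otimes>\<^bsub>S\<^esub> \<phi> g)
      \<longrightarrow> (is_Qsigma S (\<phi> ` A0 sc br L) \<longleftrightarrow> is_Qsigma S (\<phi> ` Aalg sc br)))"
proof (intro conjI allI impI)
  interpret dense_quotient_extension sc br L
    using assms by unfold_locales
  show "semiprime_sub EndR (A0 sc br L)" by (rule semiprime_A0)
  fix S :: "('s, 'm) ring_scheme" and \<phi>
  assume hyp: "ring S \<and> \<phi> ` A \<subseteq> carrier S \<and> inj_on \<phi> A \<and>
    (\<forall>f\<in>A. \<forall>g\<in>A. \<phi> (\<lambda>v. f v + g v) = \<phi> f \<oplus>\<^bsub>S\<^esub> \<phi> g \<and> \<phi> (f \<circ> g) = \<phi> f \<otimes>\<^bsub>S\<^esub> \<phi> g)"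
  have "symmetric_quotient_ring S (\<phi> ` A0 sc br L) (\<phi> ` A)"
  proof (rule symmetric_quotient_ring_image)
    show "(\<lambda>v. 0) \<in> B \<and> (\<lambda>v. - f v) \<in> B \<and> (\<lambda>v. f v + g v) \<in> B \<and> f \<circ> g \<in> B"
      if "B \<in> {A0 sc br L, A}" "f \<in> B" "g \<in> B" for B f g
    proof (cases "B = A")
      case True
      show ?thesis using that unfolding True by (intro conjI A_zero A_neg A_add A_comp)
    next
      case False
      then have "B = A0 sc br L" using that(1) by auto
      then show ?thesis using that(2,3) by (simp only: A0_closed)
    qed
    show "\<exists>h\<in>A0 sc br L. f \<circ> h \<noteq> (\<lambda>v. 0) \<and> g \<circ> h \<in> A0 sc br L"
      if "f \<in> A" "g \<in> A" "f \<noteq> (\<lambda>v. 0)" for f g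
      using A0_right_quotient that by blast
    show "\<exists>h\<in>A0 sc br L. h \<circ> f \<noteq> (\<lambda>v. 0) \<and> h \<circ> g \<in> A0 sc br L"
      if "f \<in> A" "g \<in> A" "f \<noteq> (\<lambda>v. 0)" for f g
      using A0_left_quotient that by blast
  qed (use hyp A0_closed(1) in \<open>auto simp: A0_def\<close>)
  then interpret symmetric_quotient_ring S "\<phi> ` A0 sc br L" "\<phi> ` A" .
  \<comment> \<open>Equality of the quotient rings means here that \<open>S\<close> serves one
    embedded ring exactly when it serves the other: descent and ascent along the quotient
    extension.\<close>
  show "is_Qsigma S (\<phi> ` A0 sc br L) \<longleftrightarrow> is_Qsigma S (\<phi> ` A)"
    using is_Qsigma_restrict is_Qsigma_extend by blast
qed

end
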